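(* Let $N\cong\mathbb{Z}^d$ be a lattice and let $\Delta$ be a fan in $N$ (a fan of strongly convex rational polyhedral cones in $N\otimes_{\mathbb{Z}}\mathbb{R}$). Then the monoided space $(\Delta_{top},\mathcal{M})$ associated to $\Delta$ is a fan in the sense of monoided spaces, i.e. every point of $\Delta_{top}$ has an open neighborhood $U$ such that there exists a commutative monoid $S$ with $(U,\mathcal{M}|_U)\cong(\operatorname{Spec} S,\mathcal{M}_{\operatorname{Spec} S})$ as monoided spaces.
   Context: Monoids are commutative and written additively. Spectrum of a monoid. Let $S$ be a commutative monoid. A subset $\mathfrak{a}\subseteq S$ is an ideal if $\mathfrak{a}+S\subseteq\mathfrak{a}$ (the empty set is allowed). An ideal $\mathfrak{p}\subset S$ is prime if its complement $S\setminus\mathfrak{p}$ is a submonoid of $S$ (so the empty ideal is prime). $\operatorname{Spec} S$ is the set of prime ideals of $S$, with the topology having as a base the sets $D(f)=\{\mathfrak{p}\in\operatorname{Spec} S\mid f\in S\setminus\mathfrak{p}\}$, $f\in S$, and $\mathcal{M}_{\operatorname{Spec} S}$ is the sheaf of monoids with $\Gamma(D(f),\mathcal{M}_{\operatorname{Spec} S})=S_f=S+\mathbb{N}(-f)$, the localization of $S$ obtained by inverting $f$, with the natural localization maps as restrictions. Monoided spaces. A monoided space is a pair $(X,\mathcal{M})$ of a topological space $X$ and a sheaf of monoids $\mathcal{M}$ on $X$. A morphism consists of a continuous map $\varphi:X\to X'$ and a homomorphism of sheaves of monoids $\varphi^{\#}:\mathcal{M}_{X'}\to\varphi_*\mathcal{M}_X$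 that is local, i.e. the induced maps on stalks send non-units to non-units. Thus an isomorphism is a homeomorphism together with an isomorphism of sheaves of monoids. Fan in a lattice. Put $N_{\mathbb{R}}=N\otimes_{\mathbb{Z}}\mathbb{R}$ and $M=\operatorname{Hom}_{\mathbb{Z}}(N,\mathbb{Z})$. A fan in $N$ is a collection of strongly convex rational polyhedral cones in $N_{\mathbb{R}}$ such that every face of a cone in the collection is in the collection and the intersection of any two cones in the collection is a face of each. (The empty collection counts as a fan.) A subfan of $\Delta$ is a subset of $\Delta$ that is itself a fan in $N$. The associated monoided space. $\Delta_{top}$ is the set of cones $\sigma\in\Delta$, with the topology whose open sets are the subfans of $\Delta$. For $\sigma\in\Delta$, let $\sigma_{top}\subseteq\Delta_{top}$ be the open set consisting of $\sigma$ and all its faces; this is the smallest open set containing the point $\sigma$. $\mathcal{M}$ is the sheaf of monoids on $\Delta_{top}$ with $\Gamma(\sigma_{top},\mathcal{M})=S_\sigma:=\sigma^{\vee}\cap M$ for every $\sigma\in\Delta$, where $\sigma^\vee=\{u\in \operatorname{Hom}_{\mathbb{R}}(N_{\mathbb{R}},\mathbb{R})\mid u(v)\ge 0\text{ for all }v\in\sigma\}$, and whose restriction maps $S_\sigma\to S_\tau$, for $\tau$ a face of $\sigma$, are the inclusions inside $M$ (these data determine $\mathcal{M}$, since the sets $\sigma_{top}$ are the smallest open neighborhoods of the points). *)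

theory Defs
  imports "HOL-Analysis.Abstract_Topology" "HOL-Algebra.Group"
begin

text \<open>
  Commutative monoids are those of HOL-Algebra (\<^const>\<open>comm_monoid\<close>). Their notation is
  multiplicative, so a sum \<open>a + b\<close> reads \<open>a \<otimes> b\<close>, the element 0 reads \<open>\<one>\<close> and a multiple
  \<open>n f\<close> reads \<open>f [^] n\<close>.
\<close>

section \<open>Monoided spaces\<close>

text \<open>The fields \<open>sections\<close> and \<open>restr\<close> are only meaningful on open sets; \<open>restr U V\<close> is the
  restriction map from \<open>U\<close> to the smaller open set \<open>V\<close>.\<close>

record ('p, 's) mspace =
  space_top :: "'p topology"
  sections :: "'p set \<Rightarrow> 's monoid"
  restr :: "'p set \<Rightarrow> 'p set \<Rightarrow> 's \<Rightarrow> 's"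

text \<open>The predicate \<^const>\<open>hom\<close> of HOL-Algebra does not require the neutral element to be preserved.\<close>

definition monoid_hom :: "('a, 'c) monoid_scheme \<Rightarrow> ('b, 'd) monoid_scheme \<Rightarrow> ('a \<Rightarrow> 'b) set" where
  "monoid_hom G H = {h \<in> hom G H. h \<one>\<^bsub>G\<^esub> = \<one>\<^bsub>H\<^esub>}"

definition monoid_iso :: "('a, 'c) monoid_scheme \<Rightarrow> ('b, 'd) monoid_scheme \<Rightarrow> ('a \<Rightarrow> 'b) set" where
  "monoid_iso G H = {h \<in> monoid_hom G H. bij_betw h (carrier G) (carrier H)}"

definition presheaf_of_monoids :: "('p, 's) mspace \<Rightarrow> bool" where
  "presheaf_of_monoids X \<longleftrightarrow>
     (\<forall>U. openin (space_top X) U \<longrightarrow> comm_monoid (sections X U)) \<and>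
     (\<forall>U V. openin (space_top X) U \<and> openin (space_top X) V \<and> V \<subseteq> U \<longrightarrow>
        restr X U V \<in> monoid_hom (sections X U) (sections X V)) \<and>
     (\<forall>U s. openin (space_top X) U \<and> s \<in> carrier (sections X U) \<longrightarrow> restr X U U s = s) \<and>
     (\<forall>U V W s. openin (space_top X) U \<and> openin (space_top X) V \<and> openin (space_top X) W \<and>
        W \<subseteq> V \<and> V \<subseteq> U \<and> s \<in> carrier (sections X U) \<longrightarrow>
        restr X V W (restr X U V s) = restr X U W s)"

definition gluing_condition :: "('p, 's) mspace \<Rightarrow> bool" where
  "gluing_condition X \<longleftrightarrow>
     (\<forall>\<U> s. (\<forall>U\<in>\<U>. openin (space_top X) U \<and> s U \<in> carrier (sections X U)) \<and>
        (\<forall>U\<in>\<U>. \<forall>V\<in>\<U>. restr X U (U \<inter> V) (s U) = restr X V (U \<inter> V) (s V)) \<longrightarrow>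
        (\<exists>!t. t \<in> carrier (sections X (\<Union>\<U>)) \<and> (\<forall>U\<in>\<U>. restr X (\<Union>\<U>) U t = s U)))"

definition monoided_space :: "('p, 's) mspace \<Rightarrow> bool" where
  "monoided_space X \<longleftrightarrow> presheaf_of_monoids X \<and> gluing_condition X"

text \<open>The open subspace \<open>(U, \<M>|\<^sub>U)\<close>. The open subsets of \<open>U\<close> are also open in \<open>X\<close>, so sections
  and restriction maps do not change.\<close>

definition open_subspace :: "('p, 's) mspace \<Rightarrow> 'p set \<Rightarrow> ('p, 's) mspace" where
  "open_subspace X U =
     \<lparr>space_top = subtopology (space_top X) U, sections = sections X, restr = restr X\<rparr>"

text \<open>A homeomorphism \<open>\<phi> : X \<rightarrow> Y\<close> together with an isomorphism of sheaves
  \<open>\<psi> : \<M>\<^sub>Y \<rightarrow> \<phi>\<^sub>* \<M>\<^sub>X\<close>. Such an isomorphism is automatically local on stalks.\<close>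

definition isomorphic_mspaces :: "('p, 's) mspace \<Rightarrow> ('q, 't) mspace \<Rightarrow> bool" where
  "isomorphic_mspaces X Y \<longleftrightarrow>
     (\<exists>\<phi> \<psi>. homeomorphic_map (space_top X) (space_top Y) \<phi> \<and>
        (let pre = (\<lambda>V. {x \<in> topspace (space_top X). \<phi> x \<in> V}) in
          (\<forall>V. openin (space_top Y) V \<longrightarrow>
             \<psi> V \<in> monoid_iso (sections Y V) (sections X (pre V))) \<and>
          (\<forall>V W s. openin (space_top Y) V \<and> openin (space_top Y) W \<and> W \<subseteq> V \<and>
             s \<in> carrier (sections Y V) \<longrightarrow>
             \<psi> W (restr Y V W s) = restr X (pre V) (pre W) (\<psi> V s))))"

section \<open>The sheaf determined by its values on a base\<close>

text \<open>
  Let \<open>B i\<close> (\<open>i \<in> I\<close>) be a base of the topology, with a monoid \<open>F i\<close> for every \<open>i \<in> I\<close> and a map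
  \<open>\<rho> i j : F i \<rightarrow> F j\<close> whenever \<open>B j \<subseteq> B i\<close>. The corresponding sheaf has as its sections over \<open>U\<close>
  the inverse limit of the \<open>F i\<close> over all \<open>i\<close> with \<open>B i \<subseteq> U\<close>. By lemma \<open>base_sections_iso\<close>
  below, its sections over \<open>B i\<close> are \<open>F i\<close>. (It is a sheaf as soon as \<open>F\<close> satisfies the sheaf
  condition on the base; this is so below, where no \<open>B i\<close> is covered by basic open
  sets properly contained in it.)
\<close>

definition base_sections ::
  "'i set \<Rightarrow> ('i \<Rightarrow> 'p set) \<Rightarrow> ('i \<Rightarrow> 's monoid) \<Rightarrow> ('i \<Rightarrow> 'i \<Rightarrow> 's \<Rightarrow> 's) \<Rightarrow> 'p set \<Rightarrow> ('i \<Rightarrow> 's) monoid"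
where
  "base_sections I B F \<rho> U =
     (let J = {i \<in> I. B i \<subseteq> U} in
      \<lparr>carrier = {s \<in> (\<Pi>\<^sub>E i\<in>J. carrier (F i)).
                    \<forall>i\<in>J. \<forall>j\<in>J. B j \<subseteq> B i \<longrightarrow> \<rho> i j (s i) = s j},
       mult = (\<lambda>s t. \<lambda>i\<in>J. s i \<otimes>\<^bsub>F i\<^esub> t i),
       one = (\<lambda>i\<in>J. \<one>\<^bsub>F i\<^esub>)\<rparr>)"

definition base_mspace ::
  "'p topology \<Rightarrow> 'i set \<Rightarrow> ('i \<Rightarrow> 'p set) \<Rightarrow> ('i \<Rightarrow> 's monoid) \<Rightarrow> ('i \<Rightarrow> 'i \<Rightarrow> 's \<Rightarrow> 's) \<Rightarrow>
   ('p, 'i \<Rightarrow> 's) mspace"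
where
  "base_mspace T I B F \<rho> =
     \<lparr>space_top = T,
      sections = base_sections I B F \<rho>,
      restr = (\<lambda>U V s. restrict s {i \<in> I. B i \<subseteq> V})\<rparr>"

lemma base_sections_iso:
  assumes i: "i \<in> I"
    and hom: "\<And>j. j \<in> I \<Longrightarrow> B j \<subseteq> B i \<Longrightarrow> \<rho> i j \<in> carrier (F i) \<rightarrow> carrier (F j)"
    and id: "\<And>x. x \<in> carrier (F i) \<Longrightarrow> \<rho> i i x = x"
    and comp: "\<And>j k x. j \<in> I \<Longrightarrow> k \<in> I \<Longrightarrow> B j \<subseteq> B i \<Longrightarrow> B k \<subseteq> B j \<Longrightarrow> x \<in> carrier (F i) \<Longrightarrow>
                 \<rho> j k (\<rho> i j x) = \<rho> i k x"
  shows "(\<lambda>s. s i) \<in> monoid_iso (base_sections I B F \<rho> (B i)) (F i)"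
proof -
  let ?G = "base_sections I B F \<rho> (B i)"
  define J where "J = {j \<in> I. B j \<subseteq> B i}"
  have carr: "s \<in> carrier ?G \<longleftrightarrow> s \<in> (\<Pi>\<^sub>E j\<in>J. carrier (F j)) \<and>
      (\<forall>j\<in>J. \<forall>k\<in>J. B k \<subseteq> B j \<longrightarrow> \<rho> j k (s j) = s k)" for s
    by (simp add: base_sections_def Let_def J_def)
  have iJ: "i \<in> J" using i by (simp add: J_def)
  have val: "s i \<in> carrier (F i)" if "s \<in> carrier ?G" for s
    using that iJ by (auto simp: carr)
  have "inj_on (\<lambda>s. s i) (carrier ?G)"
  proof (rule inj_onI)
    fix s t assume s: "s \<in> carrier ?G" and t: "t \<in> carrier ?G" and eq: "s i = t i"
    show "s = t"
    proof (rule PiE_ext)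
      show "s \<in> (\<Pi>\<^sub>E j\<in>J. carrier (F j))" and "t \<in> (\<Pi>\<^sub>E j\<in>J. carrier (F j))"
        using s t by (simp_all add: carr)
      fix j assume j: "j \<in> J"
      then have "B j \<subseteq> B i" by (simp add: J_def)
      then have "\<rho> i j (r i) = r j" if "r \<in> carrier ?G" for r
        using iJ j that[unfolded carr] by blast
      from this[OF s] this[OF t] have "s j = \<rho> i j (s i)" "t j = \<rho> i j (t i)" by simp_all
      then show "s j = t j" using eq by simp
    qed
  qed
  moreover have "(\<lambda>s. s i) ` carrier ?G = carrier (F i)"
  proof
    show "(\<lambda>s. s i) ` carrier ?G \<subseteq> carrier (F i)"
      using val by blast
    show "carrier (F i) \<subseteq> (\<lambda>s. s i) ` carrier ?G"
    proof
      fix x assume x: "x \<in> carrier (F i)"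
      have "restrict (\<lambda>j. \<rho> i j x) J \<in> (\<Pi>\<^sub>E j\<in>J. carrier (F j))"
        using x hom by (auto simp: J_def)
      then have "restrict (\<lambda>j. \<rho> i j x) J \<in> carrier ?G"
        using comp[OF _ _ _ _ x] by (simp add: carr J_def)
      moreover have "x = restrict (\<lambda>j. \<rho> i j x) J i"
        using iJ id[OF x] by simp
      ultimately show "x \<in> (\<lambda>s. s i) ` carrier ?G" 
        by (intro image_eqI[where x = "restrict (\<lambda>j. \<rho> i j x) J"])
    qed
  qed
  moreover have "(\<lambda>s. s i) \<in> monoid_hom ?G (F i)"
    unfolding monoid_hom_def hom_def using val i by (simp add: base_sections_def Let_def)
  ultimately show ?thesis
    by (simp add: monoid_iso_def bij_betw_def)
qed

section \<open>The spectrum of a commutative monoid\<close>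

definition monoid_ideal :: "'s monoid \<Rightarrow> 's set \<Rightarrow> bool" where
  "monoid_ideal S I \<longleftrightarrow> I \<subseteq> carrier S \<and> (\<forall>a\<in>I. \<forall>s\<in>carrier S. a \<otimes>\<^bsub>S\<^esub> s \<in> I)"

definition prime_ideals :: "'s monoid \<Rightarrow> 's set set" where
  "prime_ideals S = {p. monoid_ideal S p \<and> submonoid (carrier S - p) S}"

definition basic_open :: "'s monoid \<Rightarrow> 's \<Rightarrow> 's set set" where
  "basic_open S f = {p \<in> prime_ideals S. f \<in> carrier S - p}"

definition spec_topology :: "'s monoid \<Rightarrow> 's set topology" where
  "spec_topology S = topology (arbitrary union_of (\<lambda>U. \<exists>f\<in>carrier S. U = basic_open S f))"

text \<open>The pair \<open>(s, n)\<close> represents the element \<open>s - n f\<close> of \<open>S\<^sub>f = S + \<nat>(-f)\<close>.\<close>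

definition loc_rel :: "'s monoid \<Rightarrow> 's \<Rightarrow> (('s \<times> nat) \<times> ('s \<times> nat)) set" where
  "loc_rel S f = {((s, n), (t, m)). s \<in> carrier S \<and> t \<in> carrier S \<and>
     (\<exists>k::nat. f [^]\<^bsub>S\<^esub> k \<otimes>\<^bsub>S\<^esub> (f [^]\<^bsub>S\<^esub> m \<otimes>\<^bsub>S\<^esub> s) = f [^]\<^bsub>S\<^esub> k \<otimes>\<^bsub>S\<^esub> (f [^]\<^bsub>S\<^esub> n \<otimes>\<^bsub>S\<^esub> t))}"

definition localization :: "'s monoid \<Rightarrow> 's \<Rightarrow> ('s \<times> nat) set monoid" where
  "localization S f =
     \<lparr>carrier = (carrier S \<times> UNIV) // loc_rel S f,
      mult = (\<lambda>x y. \<Union>(s, n)\<in>x. \<Union>(t, m)\<in>y. loc_rel S f `` {(s \<otimes>\<^bsub>S\<^esub> t, n + m)}),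
      one = loc_rel S f `` {(\<one>\<^bsub>S\<^esub>, 0)}\<rparr>"

definition loc_embed :: "'s monoid \<Rightarrow> 's \<Rightarrow> 's \<Rightarrow> ('s \<times> nat) set" where
  "loc_embed S f s = loc_rel S f `` {(s, 0)}"

text \<open>The natural map \<open>S\<^sub>f \<rightarrow> S\<^sub>g\<close> for \<open>D(g) \<subseteq> D(f)\<close>: as \<open>f\<close> becomes a unit in \<open>S\<^sub>g\<close>, the
  image of \<open>s - n f\<close> is the unique \<open>y \<in> S\<^sub>g\<close> with \<open>n f + y = s\<close>.\<close>

definition loc_map :: "'s monoid \<Rightarrow> 's \<Rightarrow> 's \<Rightarrow> ('s \<times> nat) set \<Rightarrow> ('s \<times> nat) set" where
  "loc_map S f g x = (THE y. y \<in> carrier (localization S g) \<and>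
     (\<forall>(s, n)\<in>x. loc_embed S g (f [^]\<^bsub>S\<^esub> n) \<otimes>\<^bsub>localization S g\<^esub> y = loc_embed S g s))"

definition Spec :: "'s monoid \<Rightarrow> ('s set, 's \<Rightarrow> ('s \<times> nat) set) mspace" where
  "Spec S = base_mspace (spec_topology S) (carrier S) (basic_open S) (localization S) (loc_map S)"

section \<open>Fans in the sense of monoided spaces\<close>

text \<open>
  In HOL the monoid \<open>S\<close> has to range over the monoids with elements of some fixed type. The type
  of the sections of \<open>X\<close> is no restriction: an isomorphism \<open>U \<cong> Spec S\<close> identifies
  \<open>S = \<Gamma>(D(0), \<M>)\<close> with \<open>\<Gamma>(U, \<M>)\<close>.
\<close>

definition mspace_fan :: "('p, 's) mspace \<Rightarrow> bool" where
  "mspace_fan X \<longleftrightarrow> monoided_space X \<and>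
     (\<forall>x\<in>topspace (space_top X). \<exists>U. openin (space_top X) U \<and> x \<in> U \<and>
        (\<exists>S :: 's monoid. comm_monoid S \<and> isomorphic_mspaces (open_subspace X U) (Spec S)))"

section \<open>Fans in a lattice\<close>

text \<open>
  A lattice \<open>N\<close> of rank \<open>d\<close> is given inside the real vector space \<open>N\<^sub>\<real> = N \<otimes>\<^sub>\<int> \<real>\<close>, which is
  the whole type \<open>'v\<close>: a \<open>\<int>\<close>-basis of \<open>N\<close> is an \<open>\<real>\<close>-basis of \<open>N\<^sub>\<real>\<close>. The class
  \<^class>\<open>real_vector\<close> does not exclude the zero space, so \<open>d = 0\<close> is allowed.
\<close>

definition lattice_of_rank :: "nat \<Rightarrow> 'v::real_vector set \<Rightarrow> bool" where
  "lattice_of_rank d N \<longleftrightarrow>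
     (\<exists>B. finite B \<and> card B = d \<and> independent B \<and> span B = UNIV \<and>
        N = {(\<Sum>b\<in>B. of_int (c b) *\<^sub>R b) | c :: 'v \<Rightarrow> int. True})"

text \<open>\<open>M = Hom\<^sub>\<int>(N, \<int>)\<close>, as a subset of \<open>Hom\<^sub>\<real>(N\<^sub>\<real>, \<real>)\<close>.\<close>

definition dual_lattice :: "'v::real_vector set \<Rightarrow> ('v \<Rightarrow> real) set" where
  "dual_lattice N = {u. linear u \<and> (\<forall>x\<in>N. u x \<in> \<int>)}"

definition dual_cone :: "'v::real_vector set \<Rightarrow> ('v \<Rightarrow> real) set" where
  "dual_cone \<sigma> = {u. linear u \<and> (\<forall>v\<in>\<sigma>. 0 \<le> u v)}"

definition strongly_convex_rational_polyhedral_cone ::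
  "'v::real_vector set \<Rightarrow> 'v set \<Rightarrow> bool"
where
  "strongly_convex_rational_polyhedral_cone N \<sigma> \<longleftrightarrow>
     (\<exists>G. finite G \<and> G \<subseteq> N \<and> \<sigma> = {(\<Sum>v\<in>G. r v *\<^sub>R v) | r. \<forall>v\<in>G. 0 \<le> r v}) \<and>
     \<sigma> \<inter> uminus ` \<sigma> = {0}"

definition cone_face :: "'v::real_vector set \<Rightarrow> 'v set \<Rightarrow> bool" where
  "cone_face \<tau> \<sigma> \<longleftrightarrow> (\<exists>u\<in>dual_cone \<sigma>. \<tau> = \<sigma> \<inter> {v. u v = 0})"

definition lattice_fan :: "'v::real_vector set \<Rightarrow> 'v set set \<Rightarrow> bool" where
  "lattice_fan N \<Delta> \<longleftrightarrow>
     (\<forall>\<sigma>\<in>\<Delta>. strongly_convex_rational_polyhedral_cone N \<sigma>) \<and>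
     (\<forall>\<sigma>\<in>\<Delta>. \<forall>\<tau>. cone_face \<tau> \<sigma> \<longrightarrow> \<tau> \<in> \<Delta>) \<and>
     (\<forall>\<sigma>\<in>\<Delta>. \<forall>\<tau>\<in>\<Delta>. cone_face (\<sigma> \<inter> \<tau>) \<sigma> \<and> cone_face (\<sigma> \<inter> \<tau>) \<tau>)"

definition fan_topology :: "'v::real_vector set \<Rightarrow> 'v set set \<Rightarrow> 'v set topology" where
  "fan_topology N \<Delta> = topology (\<lambda>U. U \<subseteq> \<Delta> \<and> lattice_fan N U)"

definition cone_top :: "'v::real_vector set \<Rightarrow> 'v set set" where
  "cone_top \<sigma> = {\<tau>. cone_face \<tau> \<sigma>}"

definition cone_monoid :: "'v::real_vector set \<Rightarrow> 'v set \<Rightarrow> ('v \<Rightarrow> real) monoid" where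
  "cone_monoid N \<sigma> =
     \<lparr>carrier = dual_cone \<sigma> \<inter> dual_lattice N,
      mult = (\<lambda>u w v. u v + w v),
      one = (\<lambda>v. 0)\<rparr>"

definition fan_mspace ::
  "'v::real_vector set \<Rightarrow> 'v set set \<Rightarrow> ('v set, 'v set \<Rightarrow> 'v \<Rightarrow> real) mspace"
where
  "fan_mspace N \<Delta> =
     base_mspace (fan_topology N \<Delta>) \<Delta> cone_top (cone_monoid N) (\<lambda>\<sigma> \<tau> u. u)"

section \<open>Consistency of the definitions\<close>

text \<open>The two topologies are topologies with the intended open sets, and the two sheaves have the
  intended sections on the basic open sets.\<close>

lemma openin_fan_topology:
  assumes "lattice_fan N \<Delta>"
  shows "openin (fan_topology N \<Delta>) U \<longleftrightarrow> U \<subseteq> \<Delta> \<and> lattice_fan N U"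
proof -
  have "istopology (\<lambda>U. U \<subseteq> \<Delta> \<and> lattice_fan N U)"
    unfolding istopology_def
  proof (intro conjI allI impI)
    fix U V assume UV: "U \<subseteq> \<Delta> \<and> lattice_fan N U" "V \<subseteq> \<Delta> \<and> lattice_fan N V"
    then show "U \<inter> V \<subseteq> \<Delta>" by blast
    show "lattice_fan N (U \<inter> V)"
      using UV by (auto simp: lattice_fan_def)
  next
    fix \<K> assume K: "\<forall>K\<in>\<K>. K \<subseteq> \<Delta> \<and> lattice_fan N K"
    then show "\<Union>\<K> \<subseteq> \<Delta>" by blast
    then show "lattice_fan N (\<Union>\<K>)"
      using K assms unfolding lattice_fan_def by (simp add: subset_iff) metis
  qed
  then show ?thesis by (simp add: fan_topology_def topology_inverse')
qed

lemma topspace_fan_topology: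
  assumes "lattice_fan N \<Delta>"
  shows "topspace (fan_topology N \<Delta>) = \<Delta>"
  using assms by (auto simp: topspace_def openin_fan_topology)

lemma cone_face_refl: "cone_face \<sigma> \<sigma>"
proof -
  have "(\<lambda>v. 0) \<in> dual_cone \<sigma>"
    by (auto simp: dual_cone_def module_hom_zero)
  then show ?thesis unfolding cone_face_def by force
qed

lemma fan_sections_iso:
  assumes "\<sigma> \<in> \<Delta>"
  shows "(\<lambda>s. s \<sigma>) \<in> monoid_iso (sections (fan_mspace N \<Delta>) (cone_top \<sigma>)) (cone_monoid N \<sigma>)"
proof -
  have "\<tau> \<subseteq> \<sigma>" if "cone_top \<tau> \<subseteq> cone_top \<sigma>" for \<tau>
    using that cone_face_refl[of \<tau>] by (auto simp: cone_top_def cone_face_def)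
  then have "dual_cone \<sigma> \<subseteq> dual_cone \<tau>" if "cone_top \<tau> \<subseteq> cone_top \<sigma>" for \<tau>
    using that unfolding dual_cone_def by blast
  then show ?thesis
    unfolding fan_mspace_def base_mspace_def mspace.select_convs
    by (intro base_sections_iso) (use assms in \<open>auto simp: cone_monoid_def\<close>)
qed

context
  fixes S :: "'s monoid" (structure)
  assumes S: "comm_monoid S"
begin

interpretation comm_monoid S by (rule S)

lemma prime_ideal_mult_iff:
  assumes "p \<in> prime_ideals S" "f \<in> carrier S" "g \<in> carrier S"
  shows "f \<otimes> g \<in> p \<longleftrightarrow> f \<in> p \<or> g \<in> p"
proof -
  have "submonoid (carrier S - p) S" and "monoid_ideal S p"
    using assms(1) by (auto simp: prime_ideals_def)
  then show ?thesis
    using assms(2,3) submonoid.m_closed[of "carrier S - p" S f g] m_comm[of f g]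
    by (auto simp: monoid_ideal_def) metis
qed

lemma basic_open_Int:
  assumes "f \<in> carrier S" "g \<in> carrier S"
  shows "basic_open S f \<inter> basic_open S g = basic_open S (f \<otimes> g)"
  using assms by (auto simp: basic_open_def prime_ideal_mult_iff)

lemma openin_spec_topology:
  "openin (spec_topology S) = arbitrary union_of (\<lambda>U. \<exists>f\<in>carrier S. U = basic_open S f)"
  unfolding spec_topology_def
  by (intro topology_inverse' istopology_base) (use basic_open_Int m_closed in blast)

lemma topspace_spec_topology: "topspace (spec_topology S) = prime_ideals S"
proof
  show "topspace (spec_topology S) \<subseteq> prime_ideals S"
    unfolding topspace_def openin_spec_topology by (auto simp: union_of_def basic_open_def)
  have "prime_ideals S = basic_open S \<one>"
    by (auto simp: basic_open_def prime_ideals_def submonoid_def)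
  then have "openin (spec_topology S) (prime_ideals S)"
    unfolding openin_spec_topology by (auto intro!: union_of_inc simp: arbitrary_def)
  then show "prime_ideals S \<subseteq> topspace (spec_topology S)"
    by (rule openin_subset)
qed

lemma basic_open_subset_imp:
  assumes "basic_open S g \<subseteq> basic_open S f" "f \<in> carrier S" "g \<in> carrier S"
  obtains h a where "h \<in> carrier S" "g [^] (a::nat) = f \<otimes> h"
proof -
  define H where "H = {s \<in> carrier S. \<exists>h\<in>carrier S. \<exists>a::nat. g [^] a = s \<otimes> h}"
  have "submonoid H S"
  proof
    show "H \<subseteq> carrier S" by (auto simp: H_def)
    have "g [^] (0::nat) = \<one> \<otimes> \<one>" by simp
    then show "\<one> \<in> H" unfolding H_def by blast
    fix s t assume "s \<in> H" "t \<in> H"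
    then obtain h k and a b :: nat where
      "s \<in> carrier S" "t \<in> carrier S" "h \<in> carrier S" "k \<in> carrier S"
      "g [^] a = s \<otimes> h" "g [^] b = t \<otimes> k"
      unfolding H_def by blast
    moreover from this have "g [^] (a + b) = (s \<otimes> t) \<otimes> (h \<otimes> k)"
      using assms by (simp add: nat_pow_mult[symmetric] m_ac)
    ultimately show "s \<otimes> t \<in> H" unfolding H_def by blast
  qed
  moreover have "monoid_ideal S (carrier S - H)"
    unfolding monoid_ideal_def
  proof (intro conjI ballI)
    fix s t assume s: "s \<in> carrier S - H" and t: "t \<in> carrier S"
    have "s \<otimes> t \<notin> H"
    proof
      assume "s \<otimes> t \<in> H"
      then obtain h and a :: nat where "h \<in> carrier S" "g [^] a = s \<otimes> (t \<otimes> h)"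
        using s t by (auto simp: H_def m_assoc)
      then have "s \<in> H" using s t unfolding H_def by blast
      then show False using s by blast
    qed
    then show "s \<otimes> t \<in> carrier S - H" using s t by simp
  qed blast
  moreover have HG: "carrier S - (carrier S - H) = H" by (auto simp: H_def)
  moreover have "g \<in> H"
  proof -
    have "g [^] (1::nat) = g \<otimes> \<one>" using assms by simp
    then show ?thesis using assms unfolding H_def by blast
  qed
  ultimately have "carrier S - H \<in> basic_open S g"
    using assms by (simp add: basic_open_def prime_ideals_def)
  then have "carrier S - H \<in> basic_open S f" using assms(1) by blast
  then have "f \<in> H" unfolding basic_open_def HG by simp
  then show thesis using that unfolding H_def by blast
qed

lemma loc_rel_iff:
  assumes "f \<in> carrier S"
  shows "((s, n), (t, m)) \<in> loc_rel S f \<longleftrightarrow> s \<in> carrier S \<and> t \<in> carrier S \<and>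
           (\<exists>k::nat. f [^] (k + m) \<otimes> s = f [^] (k + n) \<otimes> t)"
  using assms by (auto simp: loc_rel_def nat_pow_mult[symmetric] m_assoc)

lemma equiv_loc_rel:
  assumes f: "f \<in> carrier S"
  shows "equiv (carrier S \<times> UNIV) (loc_rel S f)"
proof (rule equivI)
  show "loc_rel S f \<subseteq> (carrier S \<times> UNIV) \<times> carrier S \<times> UNIV"
    by (auto simp: loc_rel_def)
  show "refl_on (carrier S \<times> UNIV) (loc_rel S f)"
    by (auto simp: refl_on_def loc_rel_def)
  show "sym_on UNIV (loc_rel S f)"
    unfolding sym_on_def by (auto simp: loc_rel_def) metis+
  show "trans_on UNIV (loc_rel S f)"
  proof (rule transI, clarify)
    fix s n t m u p
    assume "((s, n), (t, m)) \<in> loc_rel S f" "((t, m), (u, p)) \<in> loc_rel S f"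
    then obtain k l :: nat where c: "s \<in> carrier S" "t \<in> carrier S" "u \<in> carrier S"
      and k: "f [^] (k + m) \<otimes> s = f [^] (k + n) \<otimes> t"
      and l: "f [^] (l + p) \<otimes> t = f [^] (l + m) \<otimes> u"
      by (auto simp: loc_rel_iff f)
    have "f [^] ((k + l + m) + p) \<otimes> s = f [^] (l + p) \<otimes> (f [^] (k + m) \<otimes> s)"
      using f c by (simp add: m_assoc[symmetric] nat_pow_mult ac_simps)
    also have "\<dots> = f [^] (k + n) \<otimes> (f [^] (l + p) \<otimes> t)"
      using f c by (simp add: k m_lcomm)
    also have "\<dots> = f [^] ((k + l + m) + n) \<otimes> u"
      using f c by (simp add: l m_assoc[symmetric] nat_pow_mult ac_simps)
    finally show "((s, n), (u, p)) \<in> loc_rel S f"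
      using c by (auto simp: loc_rel_iff f)
  qed
qed

lemma loc_class_eq_iff:
  assumes "f \<in> carrier S" "s \<in> carrier S" "t \<in> carrier S"
  shows "loc_rel S f `` {(s, n)} = loc_rel S f `` {(t, m)} \<longleftrightarrow>
           (\<exists>k::nat. f [^] (k + m) \<otimes> s = f [^] (k + n) \<otimes> t)"
  using eq_equiv_class_iff[OF equiv_loc_rel, of f "(s, n)" "(t, m)"] assms
  by (simp add: loc_rel_iff)

lemma localization_mult:
  assumes f: "f \<in> carrier S" and s: "s \<in> carrier S" and t: "t \<in> carrier S"
  shows "loc_rel S f `` {(s, n)} \<otimes>\<^bsub>localization S f\<^esub> loc_rel S f `` {(t, m)} =
         loc_rel S f `` {(s \<otimes> t, n + m)}"
proof -
  have *: "loc_rel S f `` {(s' \<otimes> t', n' + m')} = loc_rel S f `` {(s \<otimes> t, n + m)}"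
    if "((s, n), (s', n')) \<in> loc_rel S f" "((t, m), (t', m')) \<in> loc_rel S f" for s' n' t' m'
  proof -
    from that obtain k l :: nat where c: "s' \<in> carrier S" "t' \<in> carrier S"
      and k: "f [^] (k + n') \<otimes> s = f [^] (k + n) \<otimes> s'"
      and l: "f [^] (l + m') \<otimes> t = f [^] (l + m) \<otimes> t'"
      by (auto simp: loc_rel_iff f)
    have "f [^] ((k + l) + (n + m)) \<otimes> (s' \<otimes> t') =
          (f [^] (k + n) \<otimes> s') \<otimes> (f [^] (l + m) \<otimes> t')"
      using f c by (simp add: nat_pow_mult[symmetric] m_ac)
    also have "\<dots> = f [^] ((k + l) + (n' + m')) \<otimes> (s \<otimes> t)"
      using f s t by (simp add: k[symmetric] l[symmetric]) (simp add: nat_pow_mult[symmetric] m_ac)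
    finally show ?thesis
      using f s t c by (auto simp: loc_class_eq_iff)
  qed
  have mem: "(s, n) \<in> loc_rel S f `` {(s, n)}" "(t, m) \<in> loc_rel S f `` {(t, m)}"
    using f s t by (auto simp: loc_rel_iff)
  have UN: "(\<Union>(a, i)\<in>X. \<Union>(b, j)\<in>Y. Z a i b j) = C"
    if eq: "\<And>a i b j. (a, i) \<in> X \<Longrightarrow> (b, j) \<in> Y \<Longrightarrow> Z a i b j = C"
      and ne: "(s, n) \<in> X" "(t, m) \<in> Y"
    for X Y :: "('s \<times> nat) set" and Z and C :: "('s \<times> nat) set"
  proof
    show "(\<Union>(a, i)\<in>X. \<Union>(b, j)\<in>Y. Z a i b j) \<subseteq> C"
      using eq by fast
    show "C \<subseteq> (\<Union>(a, i)\<in>X. \<Union>(b, j)\<in>Y. Z a i b j)"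
      using eq[OF ne] ne by fast
  qed
  show ?thesis
    unfolding localization_def monoid.select_convs
    by (rule UN[OF * mem]) (simp_all only: Image_singleton_iff)
qed

lemma localization_carrierE:
  assumes "x \<in> carrier (localization S f)"
  obtains s n where "s \<in> carrier S" "x = loc_rel S f `` {(s, n)}"
  using assms by (auto simp: localization_def elim!: quotientE)

lemma localization_carrierI:
  "s \<in> carrier S \<Longrightarrow> loc_rel S f `` {(s, n)} \<in> carrier (localization S f)"
  by (auto simp: localization_def intro: quotientI)

lemma loc_map_class:
  assumes f: "f \<in> carrier S" and g: "g \<in> carrier S" and h: "h \<in> carrier S"
    and a: "g [^] (a::nat) = f \<otimes> h" and s: "s \<in> carrier S"
  shows "loc_map S f g (loc_rel S f `` {(s, n)}) = loc_rel S g `` {(s \<otimes> h [^] n, a * n)}"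
proof -
  have pow: "g [^] (a * k) = f [^] k \<otimes> h [^] k" for k :: nat
    using f g h a by (metis nat_pow_pow nat_pow_distrib)
  show ?thesis
    unfolding loc_map_def
  proof (rule the_equality, intro conjI)
    show "loc_rel S g `` {(s \<otimes> h [^] n, a * n)} \<in> carrier (localization S g)"
      using s h by (simp add: localization_carrierI)
    show "\<forall>(s', n')\<in>loc_rel S f `` {(s, n)}.
      loc_embed S g (f [^] n') \<otimes>\<^bsub>localization S g\<^esub> loc_rel S g `` {(s \<otimes> h [^] n, a * n)} =
      loc_embed S g s'"
    proof clarify
      fix s' n' assume "((s, n), (s', n')) \<in> loc_rel S f"
      then obtain k :: nat where c: "s' \<in> carrier S"
        and k: "f [^] (k + n') \<otimes> s = f [^] (k + n) \<otimes> s'"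
        by (auto simp: loc_rel_iff f)
      have "g [^] (a * k + 0) \<otimes> (f [^] n' \<otimes> (s \<otimes> h [^] n)) =
            h [^] (k + n) \<otimes> (f [^] (k + n') \<otimes> s)"
        using f h s by (simp add: pow nat_pow_mult[symmetric] m_ac)
      also have "\<dots> = g [^] (a * (k + n)) \<otimes> s'"
        using f h c by (simp only: k pow) (simp add: m_ac)
      finally have "g [^] (a * k + 0) \<otimes> (f [^] n' \<otimes> (s \<otimes> h [^] n)) =
            g [^] (a * k + a * n) \<otimes> s'"
        by (simp add: distrib_left)
      then show "loc_embed S g (f [^] n') \<otimes>\<^bsub>localization S g\<^esub>
          loc_rel S g `` {(s \<otimes> h [^] n, a * n)} = loc_embed S g s'"
        using f g h s c unfolding loc_embed_def
        by (subst localization_mult) (auto simp: loc_class_eq_iff)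
    qed
  next
    fix y assume y: "y \<in> carrier (localization S g) \<and>
      (\<forall>(s', n')\<in>loc_rel S f `` {(s, n)}.
        loc_embed S g (f [^] n') \<otimes>\<^bsub>localization S g\<^esub> y = loc_embed S g s')"
    then obtain t m where t: "t \<in> carrier S" and ty: "y = loc_rel S g `` {(t, m)}"
      by (auto elim: localization_carrierE)
    have "(s, n) \<in> loc_rel S f `` {(s, n)}" using f s by (auto simp: loc_rel_iff)
    then have "loc_embed S g (f [^] n) \<otimes>\<^bsub>localization S g\<^esub> y = loc_embed S g s"
      using y by blast
    then obtain k :: nat where k: "g [^] k \<otimes> (f [^] n \<otimes> t) = g [^] (k + m) \<otimes> s"
      using f g s t by (auto simp: loc_embed_def ty localization_mult loc_class_eq_iff)
    have "g [^] (k + a * n) \<otimes> t = h [^] n \<otimes> (g [^] k \<otimes> (f [^] n \<otimes> t))"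
      using f g h t by (simp add: nat_pow_mult[symmetric] pow m_ac)
    also have "\<dots> = g [^] (k + m) \<otimes> (s \<otimes> h [^] n)"
      using g h s by (simp add: k m_ac)
    finally show "y = loc_rel S g `` {(s \<otimes> h [^] n, a * n)}"
      unfolding ty using g h s t by (subst loc_class_eq_iff) auto
  qed
qed

lemma spec_sections_iso:
  assumes f: "f \<in> carrier S"
  shows "(\<lambda>s. s f) \<in> monoid_iso (sections (Spec S) (basic_open S f)) (localization S f)"
  unfolding Spec_def base_mspace_def mspace.select_convs
proof (rule base_sections_iso[where i = f and B = "basic_open S"])
  show "f \<in> carrier S" by fact
  show "loc_map S f g \<in> carrier (localization S f) \<rightarrow> carrier (localization S g)"
    if g: "g \<in> carrier S" "basic_open S g \<subseteq> basic_open S f" for g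
  proof
    fix x assume "x \<in> carrier (localization S f)"
    then obtain s n where s: "s \<in> carrier S" "x = loc_rel S f `` {(s, n)}"
      by (rule localization_carrierE)
    obtain h and a :: nat where "h \<in> carrier S" "g [^] a = f \<otimes> h"
      using basic_open_subset_imp[OF g(2) f g(1)] .
    then show "loc_map S f g x \<in> carrier (localization S g)"
      using f g(1) s by (simp add: loc_map_class localization_carrierI)
  qed
  show "loc_map S f f x = x" if "x \<in> carrier (localization S f)" for x
  proof -
    from that obtain s n where "s \<in> carrier S" "x = loc_rel S f `` {(s, n)}"
      by (rule localization_carrierE)
    then show ?thesis using loc_map_class[of f f \<one> 1 s n] f by simp
  qed
  show "loc_map S g k (loc_map S f g x) = loc_map S f k x"
    if g: "g \<in> carrier S" and k: "k \<in> carrier S" and gf: "basic_open S g \<subseteq> basic_open S f"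
      and kg: "basic_open S k \<subseteq> basic_open S g" and x: "x \<in> carrier (localization S f)"
    for g k x
  proof -
    obtain s n where s: "s \<in> carrier S" "x = loc_rel S f `` {(s, n)}"
      using x by (rule localization_carrierE)
    obtain h and a :: nat where h: "h \<in> carrier S" "g [^] a = f \<otimes> h"
      using basic_open_subset_imp[OF gf f g] .
    obtain h' and b :: nat where h': "h' \<in> carrier S" "k [^] b = g \<otimes> h'"
      using basic_open_subset_imp[OF kg g k] .
    have "k [^] (b * a) = (g \<otimes> h') [^] a"
      using k h'(2) by (metis nat_pow_pow)
    also have "\<dots> = f \<otimes> (h \<otimes> h' [^] a)"
      using f g h h' by (simp add: nat_pow_distrib m_assoc)
    finally have *: "k [^] (b * a) = f \<otimes> (h \<otimes> h' [^] a)" .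
    have "(h \<otimes> h' [^] a) [^] n = h [^] n \<otimes> h' [^] (a * n)"
      using h h' by (simp add: nat_pow_distrib nat_pow_pow)
    then show ?thesis
      using f g k h h' s loc_map_class[OF f k _ * s(1), of n]
      by (simp add: loc_map_class m_assoc mult.assoc)
  qed
qed

end

end

theory Submission
  imports Defs "HOL-Analysis.Kronecker_Approximation_Theorem"
begin

text \<open>
  The neighbourhood of \<open>\<sigma> \<in> \<Delta>\<close> is the set \<open>\<sigma>\<^sub>t\<^sub>o\<^sub>p\<close> of its faces, and the monoid is
  \<open>S = S\<^sub>\<sigma> = \<sigma>\<^sup>\<or> \<inter> M\<close>. A face \<open>\<tau>\<close> is sent to the prime ideal \<open>S - \<tau>\<^sup>\<bottom>\<close> of the functionals
  that do not vanish on \<open>\<tau>\<close>.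

  Two facts about rational cones carry the proof. The first, \<open>cone_face_integral\<close>, says that a face,
  which by definition is cut out by a real functional, is also cut out by an element of \<open>S\<close>. If the
  coordinates of the real functional are approximated simultaneously, with a common denominator, as
  in Dirichlet's theorem, and the denominator is cleared, then the resulting integral functional has
  the same signs on the finitely many generators: where the real functional vanishes, the integral
  one is an integer of absolute value less than 1. The second, \<open>cone_functional_dominated\<close>, says that
  if \<open>w\<close> is nonnegative on the part of \<open>\<sigma>\<close> where \<open>f \<in> S\<close> vanishes, then \<open>w + n f\<close> is nonnegative
  on \<open>\<sigma>\<close> for large \<open>n\<close>; it holds because \<open>f\<close>, being integral, is at least 1 on the
  generators on which it is not zero.

  By the first fact different faces have different primes. By the second, applied to \<open>w = - g\<close>, every
  prime comes from a face (\<open>prime_ideal_eq_face_prime\<close>). The primes in \<open>D(f)\<close> are those of the faces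
  of \<open>\<sigma> \<inter> f\<^sup>\<bottom>\<close>, so that the bases \<open>D(f)\<close> and \<open>\<tau>\<^sub>t\<^sub>o\<^sub>p\<close> correspond and the bijection is a
  homeomorphism. By the second fact again, \<open>S\<^sub>f = S\<^sub>\<tau>\<close> for \<open>\<tau> = \<sigma> \<inter> f\<^sup>\<bottom>\<close>
  (\<open>loc_value_iso\<close>). Under this identification all restriction maps are inclusions of sets of
  functionals, and the sections on both sides become the same compatible families.

  That \<open>\<M>\<close> is a sheaf at all is due to \<open>\<tau>\<^sub>t\<^sub>o\<^sub>p\<close> being the smallest open set that contains
  \<open>\<tau>\<close>: a cover of it by open sets has a member that contains all of it
  (\<open>monoided_space_base_mspace\<close>).
\<close>

section \<open>Sheaves determined by an irreducible base\<close>

lemma base_sections_carrier_iff: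
  "s \<in> carrier (base_sections I B F \<rho> U) \<longleftrightarrow>
     s \<in> extensional {i \<in> I. B i \<subseteq> U} \<and> (\<forall>i\<in>I. B i \<subseteq> U \<longrightarrow> s i \<in> carrier (F i)) \<and>
     (\<forall>i\<in>I. \<forall>j\<in>I. B i \<subseteq> U \<longrightarrow> B j \<subseteq> B i \<longrightarrow> \<rho> i j (s i) = s j)"
  by (auto simp: base_sections_def Let_def PiE_iff)

lemma base_sections_mult:
  "s \<otimes>\<^bsub>base_sections I B F \<rho> U\<^esub> t = (\<lambda>i\<in>{i \<in> I. B i \<subseteq> U}. s i \<otimes>\<^bsub>F i\<^esub> t i)"
  by (simp add: base_sections_def Let_def)

lemma base_sections_one: "\<one>\<^bsub>base_sections I B F \<rho> U\<^esub> = (\<lambda>i\<in>{i \<in> I. B i \<subseteq> U}. \<one>\<^bsub>F i\<^esub>)"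
  by (simp add: base_sections_def Let_def)

lemma base_mspace_simps:
  "space_top (base_mspace T I B F \<rho>) = T"
  "sections (base_mspace T I B F \<rho>) = base_sections I B F \<rho>"
  "restr (base_mspace T I B F \<rho>) U V s = restrict s {i \<in> I. B i \<subseteq> V}"
  by (simp_all add: base_mspace_def)

lemma comm_monoid_base_sections:
  assumes F: "\<And>i. i \<in> I \<Longrightarrow> comm_monoid (F i)"
    and hom: "\<And>i j. i \<in> I \<Longrightarrow> j \<in> I \<Longrightarrow> B j \<subseteq> B i \<Longrightarrow> \<rho> i j \<in> monoid_hom (F i) (F j)"
  shows "comm_monoid (base_sections I B F \<rho> U)"
proof (rule comm_monoidI)
  have mon: "monoid (F i)" if "i \<in> I" for i
    using F[OF that] by (simp add: comm_monoid_def)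
  show "\<one>\<^bsub>base_sections I B F \<rho> U\<^esub> \<in> carrier (base_sections I B F \<rho> U)"
    using mon hom unfolding base_sections_carrier_iff base_sections_one
    by (auto simp: monoid_hom_def monoid.one_closed)
  fix x y assume x: "x \<in> carrier (base_sections I B F \<rho> U)"
    and y: "y \<in> carrier (base_sections I B F \<rho> U)"
  have xy: "x i \<in> carrier (F i)" "y i \<in> carrier (F i)" if "i \<in> I" "B i \<subseteq> U" for i
    using x y that by (simp_all add: base_sections_carrier_iff)
  have "\<rho> i j (x i \<otimes>\<^bsub>F i\<^esub> y i) = x j \<otimes>\<^bsub>F j\<^esub> y j"
    if "i \<in> I" "j \<in> I" "B i \<subseteq> U" "B j \<subseteq> B i" for i j
    using that x y hom[of i j] by (auto simp: base_sections_carrier_iff monoid_hom_def hom_def)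
  then show "x \<otimes>\<^bsub>base_sections I B F \<rho> U\<^esub> y \<in> carrier (base_sections I B F \<rho> U)"
    using xy mon unfolding base_sections_carrier_iff base_sections_mult
    by (auto intro: monoid.m_closed)
  show "x \<otimes>\<^bsub>base_sections I B F \<rho> U\<^esub> y = y \<otimes>\<^bsub>base_sections I B F \<rho> U\<^esub> x"
    unfolding base_sections_mult using xy F by (auto intro!: restrict_ext comm_monoid.m_comm)
  show "\<one>\<^bsub>base_sections I B F \<rho> U\<^esub> \<otimes>\<^bsub>base_sections I B F \<rho> U\<^esub> x = x"
    unfolding base_sections_mult base_sections_one using x mon
    by (auto simp: base_sections_carrier_iff monoid.l_one extensional_def)
  fix z assume z: "z \<in> carrier (base_sections I B F \<rho> U)"
  then show "(x \<otimes>\<^bsub>base_sections I B F \<rho> U\<^esub> y) \<otimes>\<^bsub>base_sections I B F \<rho> U\<^esub> z =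
      x \<otimes>\<^bsub>base_sections I B F \<rho> U\<^esub> (y \<otimes>\<^bsub>base_sections I B F \<rho> U\<^esub> z)"
    unfolding base_sections_mult using xy mon
    by (auto intro!: restrict_ext simp: base_sections_carrier_iff monoid.m_assoc)
qed

text \<open>When every cover of a basic open set has a member that contains it, the component at \<open>i\<close>
  of the glued section is read off from any member of the cover that contains \<open>B i\<close>.\<close>

lemma monoided_space_base_mspace:
  assumes F: "\<And>i. i \<in> I \<Longrightarrow> comm_monoid (F i)"
    and hom: "\<And>i j. i \<in> I \<Longrightarrow> j \<in> I \<Longrightarrow> B j \<subseteq> B i \<Longrightarrow> \<rho> i j \<in> monoid_hom (F i) (F j)"
    and irred: "\<And>i \<U>. i \<in> I \<Longrightarrow> (\<And>U. U \<in> \<U> \<Longrightarrow> openin T U) \<Longrightarrow> B i \<subseteq> \<Union>\<U> \<Longrightarrow> \<exists>U\<in>\<U>. B i \<subseteq> U"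
  shows "monoided_space (base_mspace T I B F \<rho>)"
  unfolding monoided_space_def
proof
  show "presheaf_of_monoids (base_mspace T I B F \<rho>)"
    unfolding presheaf_of_monoids_def base_mspace_simps
  proof (intro conjI allI impI; (elim conjE)?)
    show "comm_monoid (base_sections I B F \<rho> U)" for U
      using F hom by (rule comm_monoid_base_sections)
    show "(\<lambda>s. restrict s {i \<in> I. B i \<subseteq> V}) \<in>
        monoid_hom (base_sections I B F \<rho> U) (base_sections I B F \<rho> V)"
      if "V \<subseteq> U" for U V
    proof -
      have "i \<in> I \<Longrightarrow> B i \<subseteq> V \<Longrightarrow> B i \<subseteq> U" for i using that by blast
      then show ?thesis
        unfolding monoid_hom_def hom_def
        by (auto simp: base_sections_carrier_iff base_sections_mult base_sections_one
            intro!: restrict_ext) blast+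
    qed
    show "restrict s {i \<in> I. B i \<subseteq> U} = s" if "s \<in> carrier (base_sections I B F \<rho> U)" for U s
      using that by (auto simp: base_sections_carrier_iff extensional_restrict)
    show "restrict (restrict s {i \<in> I. B i \<subseteq> V}) {i \<in> I. B i \<subseteq> W} = restrict s {i \<in> I. B i \<subseteq> W}"
      if "W \<subseteq> V" for V W s
      using that by (auto simp: restrict_def fun_eq_iff)
  qed
  show "gluing_condition (base_mspace T I B F \<rho>)"
    unfolding gluing_condition_def base_mspace_simps
  proof (intro allI impI; elim conjE)
    fix \<U> s
    assume U: "\<forall>U\<in>\<U>. openin T U \<and> s U \<in> carrier (base_sections I B F \<rho> U)"
      and agree: "\<forall>U\<in>\<U>. \<forall>V\<in>\<U>. restrict (s U) {i \<in> I. B i \<subseteq> U \<inter> V} =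
                    restrict (s V) {i \<in> I. B i \<subseteq> U \<inter> V}"
    have agree': "s U i = s V i" if "U \<in> \<U>" "V \<in> \<U>" "i \<in> I" "B i \<subseteq> U" "B i \<subseteq> V" for U V i
    proof -
      have "restrict (s U) {i \<in> I. B i \<subseteq> U \<inter> V} i = restrict (s V) {i \<in> I. B i \<subseteq> U \<inter> V} i"
        using agree[rule_format, OF that(1,2)] by simp
      then show ?thesis using that by simp
    qed
    define c where "c i = (SOME U. U \<in> \<U> \<and> B i \<subseteq> U)" for i
    have c: "c i \<in> \<U>" "B i \<subseteq> c i" if "i \<in> I" "B i \<subseteq> \<Union>\<U>" for i
    proof -
      have "\<exists>U. U \<in> \<U> \<and> B i \<subseteq> U" using irred[of i \<U>] that U by auto
      from someI_ex[OF this] show "c i \<in> \<U>" "B i \<subseteq> c i" by (simp_all add: c_def)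
    qed
    define t where "t = (\<lambda>i\<in>{i \<in> I. B i \<subseteq> \<Union>\<U>}. s (c i) i)"
    have t: "t i = s U i" if "U \<in> \<U>" "i \<in> I" "B i \<subseteq> U" for U i
    proof -
      have "B i \<subseteq> \<Union>\<U>" using that by blast
      then show ?thesis using that c[of i] agree'[of "c i" U i] by (simp add: t_def)
    qed
    show "\<exists>!t. t \<in> carrier (base_sections I B F \<rho> (\<Union>\<U>)) \<and>
            (\<forall>U\<in>\<U>. restrict t {i \<in> I. B i \<subseteq> U} = s U)"
    proof (rule ex1I[of _ t], intro conjI ballI)
      show "t \<in> carrier (base_sections I B F \<rho> (\<Union>\<U>))"
        unfolding base_sections_carrier_iff
      proof (intro conjI ballI impI)
        show "t \<in> extensional {i \<in> I. B i \<subseteq> \<Union>\<U>}" by (simp add: t_def)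
        fix i assume i: "i \<in> I" "B i \<subseteq> \<Union>\<U>"
        have sec: "s (c i) \<in> carrier (base_sections I B F \<rho> (c i))" using c[OF i] U by blast
        then show "t i \<in> carrier (F i)"
          using i c[OF i] by (simp add: t_def base_sections_carrier_iff)
        fix j assume j: "j \<in> I" "B j \<subseteq> B i"
        have "\<rho> i j (s (c i) i) = s (c i) j"
          using sec i j c[OF i] by (simp add: base_sections_carrier_iff)
        moreover have "t i = s (c i) i" "t j = s (c i) j"
          using t c[OF i] i j by blast+
        ultimately show "\<rho> i j (t i) = t j" by simp
      qed
      show "restrict t {i \<in> I. B i \<subseteq> U} = s U" if "U \<in> \<U>" for U
      proof
        fix i
        have "s U \<in> extensional {i \<in> I. B i \<subseteq> U}"
          using U that by (simp add: base_sections_carrier_iff)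
        then show "restrict t {i \<in> I. B i \<subseteq> U} i = s U i"
          using t[OF that, of i] by (auto simp: extensional_def)
      qed
    next
      fix t' assume t': "t' \<in> carrier (base_sections I B F \<rho> (\<Union>\<U>)) \<and>
            (\<forall>U\<in>\<U>. restrict t' {i \<in> I. B i \<subseteq> U} = s U)"
      show "t' = t"
      proof
        fix i
        show "t' i = t i"
        proof (cases "i \<in> I \<and> B i \<subseteq> \<Union>\<U>")
          case True
          then have "restrict t' {j \<in> I. B j \<subseteq> c i} i = s (c i) i"
            using t' c[of i] by auto
          then show ?thesis using True c[of i] by (simp add: t_def)
        next
          case False
          then show ?thesis
            using t' by (auto simp: base_sections_carrier_iff extensional_def t_def)
        qed
      qed
    qed
  qed
qed

section \<open>Integral functionals on rational cones\<close>

text \<open>Simultaneous Dirichlet approximation of the coordinates of \<open>u\<close> gives \<open>q \<ge> 1\<close> and an integral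
  \<open>w\<close> so close to \<open>q u\<close> on \<open>G\<close> that the difference is smaller than 1 and smaller than every
  nonzero \<open>\<bar>u g\<bar>\<close>. Hence \<open>w\<close> has the sign of \<open>u\<close> where \<open>u\<close> is not zero, and where \<open>u\<close>
  is zero \<open>w\<close> is an integer of absolute value less than 1.\<close>

lemma dual_lattice_same_signs:
  fixes N :: "'v::real_vector set"
  assumes N: "lattice_of_rank d N" and u: "linear u" and G: "finite G" "G \<subseteq> N"
  obtains w where "w \<in> dual_lattice N" "\<And>g. g \<in> G \<Longrightarrow> sgn (w g) = sgn (u g)"
proof -
  obtain B where B: "finite B" "card B = d" "independent B"
    and NB: "N = {(\<Sum>b\<in>B. of_int (c b) *\<^sub>R b) | c :: 'v \<Rightarrow> int. True}"
    using N unfolding lattice_of_rank_def by blast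
  have "\<forall>g\<in>G. \<exists>c :: 'v \<Rightarrow> int. g = (\<Sum>b\<in>B. of_int (c b) *\<^sub>R b)"
    using G(2) NB by blast
  then obtain c :: "'v \<Rightarrow> 'v \<Rightarrow> int" where c: "\<And>g. g \<in> G \<Longrightarrow> g = (\<Sum>b\<in>B. of_int (c g b) *\<^sub>R b)"
    by metis
  obtain h where h: "bij_betw h {..<d} B"
    using ex_bij_betw_nat_finite[OF B(1)] B(2) by (auto simp: atLeast0LessThan)
  \<comment> \<open>An error of \<open>1 / K\<close> in each coordinate is an error of at most \<open>L / K\<close> on \<open>G\<close>; the
    margin \<open>m\<close> is what the signs tolerate.\<close>
  define L :: real where "L = (\<Sum>g\<in>G. \<Sum>b\<in>B. \<bar>of_int (c g b)\<bar>)"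
  define m where "m = Min (insert 1 ((\<lambda>g. \<bar>u g\<bar>) ` {g \<in> G. u g \<noteq> 0}))"
  have fin: "finite (insert 1 ((\<lambda>g. \<bar>u g\<bar>) ` {g \<in> G. u g \<noteq> 0}))"
    using G(1) by simp
  have m0: "0 < m" unfolding m_def using fin by (subst Min_gr_iff) auto
  have m1: "m \<le> 1" and mg: "\<And>g. g \<in> G \<Longrightarrow> u g \<noteq> 0 \<Longrightarrow> m \<le> \<bar>u g\<bar>"
    unfolding m_def using fin by (auto intro!: Min_le)
  have L0: "0 \<le> L" unfolding L_def by (intro sum_nonneg) simp
  obtain K :: nat where K: "L / m < K" using reals_Archimedean2 by blast
  have K0: "0 < K" using K L0 m0
    by (metis divide_nonneg_pos not_gr_zero of_nat_0 order_less_le_trans less_irrefl)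
  have LK: "L / K < m" using K K0 m0 by (simp add: field_simps)
  obtain q p where q: "0 < q"
    and p: "\<And>i. i < d \<Longrightarrow> \<bar>of_int q * u (h i) - of_int (p i)\<bar> < 1 / real K"
    using Dirichlet_approx_simult[OF K0, where n = d and \<theta> = "\<lambda>i. u (h i)"] by metis
  obtain w :: "'v \<Rightarrow> real" where w: "linear w"
    and wB: "\<And>b. b \<in> B \<Longrightarrow> w b = of_int (p (inv_into {..<d} h b))"
    using linear_independent_extend[OF B(3), of "\<lambda>b. of_int (p (inv_into {..<d} h b))"] by metis
  have wN: "w x \<in> \<int>" if "x \<in> N" for x
  proof -
    obtain a :: "'v \<Rightarrow> int" where "x = (\<Sum>b\<in>B. of_int (a b) *\<^sub>R b)"
      using \<open>x \<in> N\<close> NB by blast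
    then have "w x = (\<Sum>b\<in>B. of_int (a b) * w b)" by (simp add: linear_sum[OF w] linear_cmul[OF w])
    also have "\<dots> \<in> \<int>" by (intro Ints_sum Ints_mult) (auto simp: wB)
    finally show ?thesis .
  qed
  have close: "\<bar>q * u g - w g\<bar> < m" if g: "g \<in> G" for g
  proof -
    have lin: "f g = (\<Sum>b\<in>B. of_int (c g b) * f b)" if f: "linear f" for f :: "'v \<Rightarrow> real"
      by (subst c[OF g]) (simp add: linear_sum[OF f] linear_cmul[OF f])
    have "\<bar>q * u g - w g\<bar> = \<bar>\<Sum>b\<in>B. of_int (c g b) * (q * u b - w b)\<bar>"
      unfolding lin[OF u] lin[OF w] by (simp add: sum_distrib_left sum_subtractf algebra_simps)
    also have "\<dots> \<le> (\<Sum>b\<in>B. \<bar>of_int (c g b) * (q * u b - w b)\<bar>)" by (rule sum_abs)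
    also have "\<dots> \<le> (\<Sum>b\<in>B. \<bar>of_int (c g b)\<bar> * (1 / K))"
    proof (rule sum_mono)
      fix b assume b: "b \<in> B"
      define i where "i = inv_into {..<d} h b"
      have "i < d" "h i = b"
        using h b unfolding i_def
        by (metis bij_betw_imp_surj_on inv_into_into lessThan_iff) (metis h b bij_betw_inv_into_right)
      then have "\<bar>q * u b - w b\<bar> \<le> 1 / K" using p[of i] wB[OF b] by (simp add: i_def)
      then show "\<bar>of_int (c g b) * (q * u b - w b)\<bar> \<le> \<bar>of_int (c g b)\<bar> * (1 / K)"
        by (subst abs_mult) (rule mult_left_mono, simp_all)
    qed
    also have "\<dots> = (\<Sum>b\<in>B. \<bar>of_int (c g b)\<bar>) / K" by (simp add: sum_divide_distrib)
    also have "\<dots> \<le> L / K"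
      unfolding L_def using G(1) g
      by (intro divide_right_mono member_le_sum) (auto intro: sum_nonneg)
    finally show ?thesis using LK by simp
  qed
  have "sgn (w g) = sgn (u g)" if g: "g \<in> G" for g
  proof (cases "u g = 0")
    case True
    then have "\<bar>w g\<bar> < 1" using close[OF g] m1 by simp
    moreover have "w g \<in> \<int>" using wN G(2) g by blast
    ultimately show ?thesis using True by (metis Ints_nonzero_abs_ge1 not_less sgn_0)
  next
    case False
    have "1 * \<bar>u g\<bar> \<le> q * \<bar>u g\<bar>" using q by (intro mult_right_mono) auto
    moreover have "q * u g = q * \<bar>u g\<bar> \<or> q * u g = - (q * \<bar>u g\<bar>) \<and> u g < 0"
      by (simp add: abs_if)
    ultimately have "u g > 0 \<Longrightarrow> w g > 0" "u g < 0 \<Longrightarrow> w g < 0"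
      using close[OF g] mg[OF g False] False by linarith+
    then show ?thesis using False by (cases "u g > 0") (simp_all add: sgn_if)
  qed
  moreover have "w \<in> dual_lattice N" using w wN by (simp add: dual_lattice_def)
  ultimately show thesis using that by blast
qed

lemma rational_coneE:
  assumes "strongly_convex_rational_polyhedral_cone N \<sigma>"
  obtains G where "finite G" "G \<subseteq> N" "G \<subseteq> \<sigma>"
    "\<forall>v\<in>\<sigma>. \<exists>r. (\<forall>g\<in>G. 0 \<le> r g) \<and> v = (\<Sum>g\<in>G. r g *\<^sub>R g)"
proof -
  obtain G where G: "finite G" "G \<subseteq> N"
    and \<sigma>: "\<sigma> = {(\<Sum>v\<in>G. r v *\<^sub>R v) | r. \<forall>v\<in>G. 0 \<le> r v}"
    using assms unfolding strongly_convex_rational_polyhedral_cone_def by blast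
  have "g \<in> \<sigma>" if "g \<in> G" for g
  proof -
    have "g = (\<Sum>v\<in>G. (if v = g then 1 else 0) *\<^sub>R v)"
      using G(1) that by (simp add: if_distrib[of "\<lambda>r. r *\<^sub>R _"] cong: if_cong)
    then show ?thesis unfolding \<sigma> by (intro CollectI exI conjI) auto
  qed
  then show thesis using that[of G] G \<sigma> by blast
qed

lemma linear_combination: "linear f \<Longrightarrow> f (\<Sum>g\<in>G. r g *\<^sub>R g) = (\<Sum>g\<in>G. r g * f g)" for f :: "_ \<Rightarrow> real"
  by (simp add: linear_sum linear_cmul)

lemma cone_functional_nonneg:
  fixes f :: "'v::real_vector \<Rightarrow> real"
  assumes "linear f" "\<forall>g\<in>G. 0 \<le> r g" "\<And>g. g \<in> G \<Longrightarrow> 0 \<le> f g"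
  shows "0 \<le> f (\<Sum>g\<in>G. r g *\<^sub>R g)"
  using assms by (auto simp: linear_combination intro!: sum_nonneg)

lemma cone_functional_zero_iff:
  fixes f :: "'v::real_vector \<Rightarrow> real"
  assumes "linear f" "finite G" "\<forall>g\<in>G. 0 \<le> r g" "\<And>g. g \<in> G \<Longrightarrow> 0 \<le> f g"
  shows "f (\<Sum>g\<in>G. r g *\<^sub>R g) = 0 \<longleftrightarrow> (\<forall>g\<in>G. r g = 0 \<or> f g = 0)"
  using assms by (simp add: linear_combination sum_nonneg_eq_0_iff)

text \<open>The zero set of a nonnegative functional in a cone is determined by the generators on which it
  vanishes, so an integral functional with the same signs on the generators cuts out the same face.\<close>

lemma cone_face_integral:
  assumes N: "lattice_of_rank d N" and \<sigma>: "strongly_convex_rational_polyhedral_cone N \<sigma>"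
    and \<tau>: "cone_face \<tau> \<sigma>"
  obtains f where "f \<in> dual_cone \<sigma> \<inter> dual_lattice N" "\<tau> = {v \<in> \<sigma>. f v = 0}"
proof -
  obtain u where "u \<in> dual_cone \<sigma>" and \<tau>u: "\<tau> = \<sigma> \<inter> {v. u v = 0}"
    using \<tau> unfolding cone_face_def by blast
  then have u: "linear u" "\<And>v. v \<in> \<sigma> \<Longrightarrow> 0 \<le> u v" by (simp_all add: dual_cone_def)
  obtain G where G: "finite G" "G \<subseteq> N" "G \<subseteq> \<sigma>"
    and gen: "\<forall>v\<in>\<sigma>. \<exists>r. (\<forall>g\<in>G. 0 \<le> r g) \<and> v = (\<Sum>g\<in>G. r g *\<^sub>R g)"
    by (rule rational_coneE[OF \<sigma>])
  obtain f where f: "f \<in> dual_lattice N" and sgn: "\<And>g. g \<in> G \<Longrightarrow> sgn (f g) = sgn (u g)"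
    using dual_lattice_same_signs[OF N u(1) G(1,2)] by blast
  have lin: "linear f" using f by (simp add: dual_lattice_def)
  have uG: "0 \<le> u g" if "g \<in> G" for g using u(2) G(3) that by blast
  have fG: "0 \<le> f g" if "g \<in> G" for g
    using sgn[OF that] uG[OF that] by (simp add: sgn_if split: if_splits)
  have zero: "f g = 0 \<longleftrightarrow> u g = 0" if "g \<in> G" for g using sgn[OF that] by (metis sgn_0_0)
  have "0 \<le> f v \<and> (f v = 0 \<longleftrightarrow> u v = 0)" if "v \<in> \<sigma>" for v
  proof -
    obtain r where r: "\<forall>g\<in>G. 0 \<le> r g" and v: "v = (\<Sum>g\<in>G. r g *\<^sub>R g)" using gen \<open>v \<in> \<sigma>\<close> by blast
    show ?thesis unfolding v
      using cone_functional_nonneg[OF lin r fG] cone_functional_zero_iff[OF lin G(1) r fG]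
        cone_functional_zero_iff[OF u(1) G(1) r uG] zero by auto
  qed
  then show thesis using that[of f] f lin by (auto simp: \<tau>u dual_cone_def)
qed

text \<open>On a generator where \<open>f\<close> vanishes \<open>w\<close> is nonnegative by assumption; on the others the large
  multiple of \<open>f\<close> dominates. This is used with \<open>w \<in> S\<^sub>\<tau>\<close> for localizations and with the
  negative of an element of \<open>S\<^sub>\<sigma>\<close> for prime ideals.\<close>

lemma cone_functional_dominated:
  fixes f w :: "'v::real_vector \<Rightarrow> real"
  assumes \<sigma>: "strongly_convex_rational_polyhedral_cone N \<sigma>"
    and f: "f \<in> dual_cone \<sigma> \<inter> dual_lattice N" and w: "linear w"
    and pos: "\<And>v. v \<in> \<sigma> \<Longrightarrow> f v = 0 \<Longrightarrow> 0 \<le> w v"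
  obtains n :: nat where "\<And>v. v \<in> \<sigma> \<Longrightarrow> 0 \<le> w v + n * f v"
proof -
  obtain G where G: "finite G" "G \<subseteq> N" "G \<subseteq> \<sigma>"
    and gen: "\<forall>v\<in>\<sigma>. \<exists>r. (\<forall>g\<in>G. 0 \<le> r g) \<and> v = (\<Sum>g\<in>G. r g *\<^sub>R g)"
    by (rule rational_coneE[OF \<sigma>])
  have f': "linear f" "\<And>v. v \<in> \<sigma> \<Longrightarrow> 0 \<le> f v" "\<And>v. v \<in> N \<Longrightarrow> f v \<in> \<int>"
    using f by (auto simp: dual_cone_def dual_lattice_def)
  obtain n :: nat where n: "(\<Sum>g\<in>G. \<bar>w g\<bar>) \<le> n" using real_arch_simple by blast
  have lin: "linear (\<lambda>v. w v + n * f v)"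
    using linear_compose_add[OF w linear_compose_scale_right[OF f'(1), of "real n"]] by simp
  have "0 \<le> w g + n * f g" if g: "g \<in> G" for g
  proof (cases "f g = 0")
    case True
    then show ?thesis using pos[of g] g G(3) by auto
  next
    case False
    \<comment> \<open>Integrality gives a uniform lower bound: a generator off the face has value at least 1.\<close>
    then have "1 \<le> f g" using f'(2)[of g] f'(3)[of g] g G(2,3) Ints_nonzero_abs_ge1[of "f g"] by force
    then have "real n * 1 \<le> n * f g" by (intro mult_left_mono) auto
    moreover have "\<bar>w g\<bar> \<le> (\<Sum>g\<in>G. \<bar>w g\<bar>)" using G(1) g by (intro member_le_sum) auto
    ultimately show ?thesis using n by linarith
  qed
  note nonneg = this
  have "0 \<le> w v + n * f v" if v: "v \<in> \<sigma>" for v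
  proof -
    obtain r where r: "\<forall>g\<in>G. 0 \<le> r g" and v: "v = (\<Sum>g\<in>G. r g *\<^sub>R g)" using gen v by blast
    show ?thesis unfolding v by (rule cone_functional_nonneg[OF lin r nonneg])
  qed
  then show thesis using that by blast
qed

text \<open>Although \<open>F\<close> may be infinite, there are only finitely many generators. A sum of members of \<open>F\<close>,
  one for each generator on which some member is not zero, vanishes only where all of \<open>F\<close> does.\<close>

lemma common_zero_set_attained:
  assumes \<sigma>: "strongly_convex_rational_polyhedral_cone N \<sigma>"
    and F: "F \<subseteq> dual_cone \<sigma>" and zero: "(\<lambda>v. 0) \<in> F"
    and add: "\<And>u w. u \<in> F \<Longrightarrow> w \<in> F \<Longrightarrow> (\<lambda>v. u v + w v) \<in> F"
  obtains f where "f \<in> F" "\<And>u v. u \<in> F \<Longrightarrow> v \<in> \<sigma> \<Longrightarrow> f v = 0 \<Longrightarrow> u v = 0"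
proof -
  obtain G where G: "finite G" "G \<subseteq> N" "G \<subseteq> \<sigma>"
    and gen: "\<forall>v\<in>\<sigma>. \<exists>r. (\<forall>g\<in>G. 0 \<le> r g) \<and> v = (\<Sum>g\<in>G. r g *\<^sub>R g)"
    by (rule rational_coneE[OF \<sigma>])
  have lin: "linear u" and nonneg: "\<And>v. v \<in> \<sigma> \<Longrightarrow> 0 \<le> u v" if "u \<in> F" for u
    using F that by (auto simp: dual_cone_def)
  have "\<exists>f\<in>F. \<forall>u\<in>F. \<forall>g\<in>H. f g = 0 \<longrightarrow> u g = 0" if "finite H" "H \<subseteq> \<sigma>" for H
    using that
  proof (induction H)
    case empty
    then show ?case using zero by blast
  next
    case (insert g H)
    then obtain f where f: "f \<in> F" "\<And>u x. u \<in> F \<Longrightarrow> x \<in> H \<Longrightarrow> f x = 0 \<Longrightarrow> u x = 0" by auto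
    show ?case
    proof (cases "\<exists>w\<in>F. w g \<noteq> 0")
      case True
      then obtain w where w: "w \<in> F" "w g \<noteq> 0" by blast
      have *: "f x + w x = 0 \<longleftrightarrow> f x = 0 \<and> w x = 0" if "x \<in> \<sigma>" for x
        using nonneg[OF f(1) that] nonneg[OF w(1) that] by linarith
      show ?thesis
        by (rule bexI[OF _ add[OF f(1) w(1)]]) (use * insert.prems f(2) w(2) in auto)
    next
      case False
      then show ?thesis using f by blast
    qed
  qed
  from this[OF G(1,3)] obtain f where f: "f \<in> F" "\<And>u g. u \<in> F \<Longrightarrow> g \<in> G \<Longrightarrow> f g = 0 \<Longrightarrow> u g = 0"
    by blast
  have "u v = 0" if u: "u \<in> F" and v: "v \<in> \<sigma>" and fv: "f v = 0" for u v
  proof -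
    obtain r where r: "\<forall>g\<in>G. 0 \<le> r g" and v: "v = (\<Sum>g\<in>G. r g *\<^sub>R g)" using gen v by blast
    have "0 \<le> f g" "0 \<le> u g" if "g \<in> G" for g using nonneg f(1) u G(3) that by blast+
    then show ?thesis
      using fv cone_functional_zero_iff[OF lin[OF f(1)] G(1) r]
        cone_functional_zero_iff[OF lin[OF u] G(1) r] f(2)[OF u] unfolding v by blast
  qed
  then show thesis using that f(1) by blast
qed

section \<open>Faces and open sets of a fan\<close>

lemma comm_monoid_cone_monoid: "comm_monoid (cone_monoid N \<sigma>)"
  by (rule comm_monoidI)
    (auto simp: cone_monoid_def dual_cone_def dual_lattice_def module_hom_zero
      intro: linear_compose_add)

text \<open>In a fan the face relation is inclusion, because \<open>\<rho> = \<rho> \<inter> \<tau>\<close> is a face of \<open>\<tau>\<close> as soon as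
  \<open>\<rho> \<subseteq> \<tau>\<close>. In particular it is transitive.\<close>

lemma fan_cone_top_eq:
  assumes "lattice_fan N \<Delta>" "\<tau> \<in> \<Delta>"
  shows "cone_top \<tau> = {\<rho> \<in> \<Delta>. \<rho> \<subseteq> \<tau>}"
proof -
  have "cone_face \<rho> \<tau>" if "\<rho> \<in> \<Delta>" "\<rho> \<subseteq> \<tau>" for \<rho>
    using assms that unfolding lattice_fan_def by (metis Int_absorb1)
  moreover have "\<rho> \<subseteq> \<tau>" if "cone_face \<rho> \<tau>" for \<rho>
    using that by (auto simp: cone_face_def)
  ultimately show ?thesis
    using assms unfolding cone_top_def lattice_fan_def by blast
qed

lemma fan_openin_iff:
  assumes "lattice_fan N \<Delta>"
  shows "openin (fan_topology N \<Delta>) U \<longleftrightarrow> U \<subseteq> \<Delta> \<and> (\<forall>\<tau>\<in>U. cone_top \<tau> \<subseteq> U)"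
proof -
  have "lattice_fan N U \<longleftrightarrow> (\<forall>\<tau>\<in>U. cone_top \<tau> \<subseteq> U)" if "U \<subseteq> \<Delta>"
    using assms that unfolding lattice_fan_def cone_top_def by blast
  then show ?thesis using openin_fan_topology[OF assms] by blast
qed

lemma cone_top_subset_iff:
  assumes "lattice_fan N \<Delta>" "\<tau> \<in> \<Delta>" "openin (fan_topology N \<Delta>) U"
  shows "cone_top \<tau> \<subseteq> U \<longleftrightarrow> \<tau> \<in> U"
  using assms cone_face_refl[of \<tau>] by (auto simp: fan_openin_iff cone_top_def)

lemma monoided_space_fan_mspace:
  assumes fan: "lattice_fan N \<Delta>"
  shows "monoided_space (fan_mspace N \<Delta>)"
  unfolding fan_mspace_def
proof (rule monoided_space_base_mspace)
  show "comm_monoid (cone_monoid N \<sigma>)" for \<sigma> by (rule comm_monoid_cone_monoid)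
  fix \<sigma> assume \<sigma>: "\<sigma> \<in> \<Delta>"
  show "(\<lambda>u. u) \<in> monoid_hom (cone_monoid N \<sigma>) (cone_monoid N \<tau>)"
    if "\<tau> \<in> \<Delta>" "cone_top \<tau> \<subseteq> cone_top \<sigma>" for \<tau>
  proof -
    have "\<tau> \<subseteq> \<sigma>" using that fan_cone_top_eq[OF fan \<sigma>] fan_cone_top_eq[OF fan \<open>\<tau> \<in> \<Delta>\<close>] by auto
    then have "dual_cone \<sigma> \<subseteq> dual_cone \<tau>" unfolding dual_cone_def by blast
    then show ?thesis
      unfolding monoid_hom_def hom_def cone_monoid_def by simp blast
  qed
  fix \<U> assume "\<And>U. U \<in> \<U> \<Longrightarrow> openin (fan_topology N \<Delta>) U" "cone_top \<sigma> \<subseteq> \<Union>\<U>"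
  then show "\<exists>U\<in>\<U>. cone_top \<sigma> \<subseteq> U"
    using cone_top_subset_iff[OF fan \<sigma>] cone_face_refl[of \<sigma>] unfolding cone_top_def by auto
qed

section \<open>Faces of a cone and primes of its monoid\<close>

text \<open>
  Here \<open>S\<close> is a copy of \<open>S\<^sub>\<sigma>\<close>, identified with it by \<open>e\<close>. The copy matters because the monoid
  of a chart must have elements of the same type as the sections of the monoided space, which are
  families of functionals and not functionals: the theorem is applied to
  \<open>S = \<Gamma>(\<sigma>\<^sub>t\<^sub>o\<^sub>p, \<M>)\<close>.
\<close>

locale affine_chart = comm_monoid S
  for S :: "'s monoid" (structure) +
  fixes N :: "'v::real_vector set" and d :: nat and \<Delta> :: "'v set set" and \<sigma> :: "'v set"
    and e :: "'s \<Rightarrow> 'v \<Rightarrow> real"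
  assumes lattice: "lattice_of_rank d N" and fan: "lattice_fan N \<Delta>" and cone_in_fan: "\<sigma> \<in> \<Delta>"
    and chart_iso: "e \<in> monoid_iso S (cone_monoid N \<sigma>)"
begin

lemma rational_cone: "strongly_convex_rational_polyhedral_cone N \<sigma>"
  using fan cone_in_fan by (simp add: lattice_fan_def)

lemma e_in: "f \<in> carrier S \<Longrightarrow> e f \<in> dual_cone \<sigma> \<inter> dual_lattice N"
  using chart_iso by (auto simp: monoid_iso_def cone_monoid_def dest: bij_betwE)

lemma e_nonneg: "f \<in> carrier S \<Longrightarrow> v \<in> \<sigma> \<Longrightarrow> 0 \<le> e f v"
  using e_in[of f] by (auto simp: dual_cone_def)

lemma e_linear: "f \<in> carrier S \<Longrightarrow> linear (e f)"
  using e_in[of f] by (auto simp: dual_cone_def)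

lemma e_mult: "f \<in> carrier S \<Longrightarrow> g \<in> carrier S \<Longrightarrow> e (f \<otimes> g) = (\<lambda>v. e f v + e g v)"
  using chart_iso by (simp add: monoid_iso_def monoid_hom_def hom_def cone_monoid_def)

lemma e_one: "e \<one> = (\<lambda>v. 0)"
  using chart_iso by (simp add: monoid_iso_def monoid_hom_def cone_monoid_def)

lemma e_pow: "f \<in> carrier S \<Longrightarrow> e (f [^] (n::nat)) = (\<lambda>v. n * e f v)"
  by (induction n) (auto simp: e_one e_mult algebra_simps)

lemma e_eq_iff: "f \<in> carrier S \<Longrightarrow> g \<in> carrier S \<Longrightarrow> e f = e g \<longleftrightarrow> f = g"
  using chart_iso by (auto simp: monoid_iso_def dest!: bij_betw_imp_inj_on inj_onD)

lemma e_surj: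
  assumes "u \<in> dual_cone \<sigma> \<inter> dual_lattice N"
  obtains f where "f \<in> carrier S" "e f = u"
proof -
  have "u \<in> e ` carrier S"
    using chart_iso assms by (simp add: monoid_iso_def cone_monoid_def bij_betw_def)
  then show thesis using that by blast
qed

definition vanishing_face :: "'s \<Rightarrow> 'v set" where
  "vanishing_face f = {v \<in> \<sigma>. e f v = 0}"

text \<open>A prime ideal: the complement \<open>S \<inter> \<tau>\<^sup>\<bottom>\<close> is a submonoid, and
  by nonnegativity a sum lies in it only if both summands do.\<close>

definition face_prime :: "'v set \<Rightarrow> 's set" where
  "face_prime \<tau> = {f \<in> carrier S. \<exists>v\<in>\<tau>. e f v \<noteq> 0}"

lemma vanishing_face_in: "f \<in> carrier S \<Longrightarrow> vanishing_face f \<in> cone_top \<sigma>"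
  using e_in[of f] by (auto simp: cone_top_def cone_face_def vanishing_face_def)

text \<open>A face is cut out by a real functional, but elements of \<open>S\<close> are integral; the rational
  structure of the cone is what makes every face visible in \<open>S\<close>.\<close>

lemma vanishing_face_surj:
  assumes "\<tau> \<in> cone_top \<sigma>"
  obtains f where "f \<in> carrier S" "vanishing_face f = \<tau>"
proof -
  have "cone_face \<tau> \<sigma>" using assms by (simp add: cone_top_def)
  then obtain u where u: "u \<in> dual_cone \<sigma> \<inter> dual_lattice N" and \<tau>: "\<tau> = {v \<in> \<sigma>. u v = 0}"
    by (rule cone_face_integral[OF lattice rational_cone])
  from u obtain f where "f \<in> carrier S" "e f = u" by (rule e_surj)
  then show thesis using that \<tau> by (simp add: vanishing_face_def)
qed

lemma cone_top_subset_fan: "cone_top \<sigma> \<subseteq> \<Delta>"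
  using fan_cone_top_eq[OF fan cone_in_fan] by blast

lemma cone_top_face:
  assumes "\<tau> \<in> cone_top \<sigma>"
  shows "cone_top \<tau> = {\<rho> \<in> cone_top \<sigma>. \<rho> \<subseteq> \<tau>}"
proof -
  have "\<tau> \<in> \<Delta>" "\<tau> \<subseteq> \<sigma>" using assms by (simp_all add: fan_cone_top_eq[OF fan cone_in_fan])
  then show ?thesis by (auto simp: fan_cone_top_eq[OF fan cone_in_fan] fan_cone_top_eq[OF fan \<open>\<tau> \<in> \<Delta>\<close>])
qed

lemma notin_face_prime_iff:
  "\<tau> \<in> cone_top \<sigma> \<Longrightarrow> f \<in> carrier S \<Longrightarrow> f \<notin> face_prime \<tau> \<longleftrightarrow> \<tau> \<subseteq> vanishing_face f"
  by (auto simp: face_prime_def vanishing_face_def cone_top_def cone_face_def)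

lemma face_prime_in_prime_ideals:
  assumes "\<tau> \<in> cone_top \<sigma>"
  shows "face_prime \<tau> \<in> prime_ideals S"
proof -
  have \<tau>: "\<tau> \<subseteq> \<sigma>" using assms by (auto simp: cone_top_def cone_face_def)
  have "e f v + e g v \<noteq> 0" if "f \<in> carrier S" "g \<in> carrier S" "v \<in> \<tau>" "e f v \<noteq> 0" for f g v
    using e_nonneg[of f v] e_nonneg[of g v] that \<tau> by auto
  then have "monoid_ideal S (face_prime \<tau>)"
    unfolding monoid_ideal_def face_prime_def by (auto simp: e_mult)
  moreover have "submonoid (carrier S - face_prime \<tau>) S"
    by standard (auto simp: face_prime_def e_one e_mult)
  ultimately show ?thesis by (simp add: prime_ideals_def)
qed

text \<open>
  The complement \<open>F\<close> of a prime ideal has an element \<open>f\<close> whose zero set in \<open>\<sigma>\<close> is the common zero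
  set \<open>\<tau>\<close> of all of \<open>F\<close>. If \<open>g \<in> S\<close> vanishes on \<open>\<tau>\<close>, then \<open>n f - g\<close> is again in \<open>S\<close> for large
  \<open>n\<close>, so \<open>g\<close> is a summand of \<open>n f \<in> F\<close> and hence in \<open>F\<close> by primality. Thus \<open>F\<close> is
  \<open>S \<inter> \<tau>\<^sup>\<bottom>\<close>.
\<close>

lemma prime_ideal_eq_face_prime:
  assumes p: "p \<in> prime_ideals S"
  obtains \<tau> where "\<tau> \<in> cone_top \<sigma>" "face_prime \<tau> = p"
proof -
  have sub: "submonoid (carrier S - p) S" and pS: "p \<subseteq> carrier S"
    using p by (auto simp: prime_ideals_def monoid_ideal_def)
  define F where "F = e ` (carrier S - p)"
  have F: "F \<subseteq> dual_cone \<sigma>" using e_in by (auto simp: F_def)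
  have zero: "(\<lambda>v. 0) \<in> F"
    unfolding F_def using submonoid.one_closed[OF sub] e_one by (metis image_eqI)
  have add: "(\<lambda>v. u v + w v) \<in> F" if "u \<in> F" "w \<in> F" for u w
  proof -
    obtain f g where "f \<in> carrier S - p" "g \<in> carrier S - p" "u = e f" "w = e g"
      using \<open>u \<in> F\<close> \<open>w \<in> F\<close> by (auto simp: F_def)
    then have "f \<otimes> g \<in> carrier S - p" "e (f \<otimes> g) = (\<lambda>v. u v + w v)"
      using submonoid.m_closed[OF sub] by (auto simp: e_mult)
    then show ?thesis unfolding F_def by (metis image_eqI)
  qed
  obtain u where "u \<in> F" and u0: "\<And>w v. w \<in> F \<Longrightarrow> v \<in> \<sigma> \<Longrightarrow> u v = 0 \<Longrightarrow> w v = 0"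
    using common_zero_set_attained[OF rational_cone F zero add] by metis
  then obtain f where f: "f \<in> carrier S" "f \<notin> p" "u = e f" by (auto simp: F_def)
  have "g \<notin> p \<longleftrightarrow> g \<notin> face_prime (vanishing_face f)" if g: "g \<in> carrier S" for g
  proof
    assume "g \<notin> p"
    then have "e g \<in> F" using g by (simp add: F_def)
    then show "g \<notin> face_prime (vanishing_face f)"
      using u0 f(3) by (auto simp: face_prime_def vanishing_face_def)
  next
    assume "g \<notin> face_prime (vanishing_face f)"
    then have g0: "e g v = 0" if "v \<in> \<sigma>" "e f v = 0" for v
      using that g by (auto simp: face_prime_def vanishing_face_def)
    have lin: "linear (\<lambda>v. - e g v)" using e_linear[OF g] by (rule linear_compose_neg)
    obtain n :: nat where n: "\<And>v. v \<in> \<sigma> \<Longrightarrow> 0 \<le> - e g v + n * e f v"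
      using cone_functional_dominated[OF rational_cone e_in[OF f(1)] lin] g0 by auto
    have "(\<lambda>v. - e g v + n * e f v) \<in> dual_cone \<sigma> \<inter> dual_lattice N"
      using n linear_compose_add[OF lin linear_compose_scale_right[OF e_linear[OF f(1)], of "real n"]]
        e_in[OF f(1)] e_in[OF g]
      by (auto simp: dual_cone_def dual_lattice_def intro!: Ints_diff Ints_mult)
    then obtain k where k: "k \<in> carrier S" "e k = (\<lambda>v. - e g v + n * e f v)"
      by (rule e_surj)
    have "e (g \<otimes> k) = e (f [^] n)"
      using f(1) g k by (simp add: e_mult e_pow)
    then have "g \<otimes> k = f [^] n" using f(1) g k by (simp add: e_eq_iff)
    moreover have "f [^] n \<notin> p"
    proof (induction n)
      case 0
      then show ?case using submonoid.one_closed[OF sub] by simp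
    next
      case (Suc n)
      then show ?case using f prime_ideal_mult_iff[OF comm_monoid_axioms p, of "f [^] n" f] by simp
    qed
    ultimately show "g \<notin> p" using prime_ideal_mult_iff[OF comm_monoid_axioms p g k(1)] by simp
  qed
  then have "face_prime (vanishing_face f) = p"
    using pS by (auto simp: face_prime_def)
  then show thesis using that[OF vanishing_face_in[OF f(1)]] by blast
qed

lemma face_prime_bij: "bij_betw face_prime (cone_top \<sigma>) (prime_ideals S)"
  unfolding bij_betw_def
proof
  \<comment> \<open>A single equation of \<open>\<tau>\<close> recovers the inclusion, as it lies outside the prime of \<open>\<tau>\<close>.\<close>
  have *: "\<tau>' \<subseteq> \<tau>"
    if \<tau>: "\<tau> \<in> cone_top \<sigma>" and \<tau>': "\<tau>' \<in> cone_top \<sigma>" and eq: "face_prime \<tau> = face_prime \<tau>'" for \<tau> \<tau>'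
  proof -
    obtain f where f: "f \<in> carrier S" "vanishing_face f = \<tau>"
      using \<tau> by (rule vanishing_face_surj)
    then show ?thesis
      using notin_face_prime_iff[OF \<tau> f(1)] notin_face_prime_iff[OF \<tau>' f(1)] eq by simp
  qed
  show "inj_on face_prime (cone_top \<sigma>)"
    by (intro inj_onI subset_antisym *) simp_all
  show "face_prime ` cone_top \<sigma> = prime_ideals S"
    using face_prime_in_prime_ideals by (auto elim: prime_ideal_eq_face_prime)
qed

lemma face_prime_in_basic_open_iff:
  assumes "\<tau> \<in> cone_top \<sigma>" "f \<in> carrier S"
  shows "face_prime \<tau> \<in> basic_open S f \<longleftrightarrow> \<tau> \<subseteq> vanishing_face f"
  using assms face_prime_in_prime_ideals notin_face_prime_iff by (auto simp: basic_open_def)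

text \<open>The two bases correspond: \<open>f\<close> lies outside the prime of \<open>\<tau>\<close> exactly if \<open>\<tau>\<close> lies in the face
  on which \<open>f\<close> vanishes, so \<open>D(f)\<close> is the set of primes of the faces of that face.\<close>

lemma face_prime_image_cone_top:
  assumes "f \<in> carrier S"
  shows "face_prime ` cone_top (vanishing_face f) = basic_open S f"
proof -
  have "p \<in> face_prime ` {\<rho> \<in> cone_top \<sigma>. \<rho> \<subseteq> vanishing_face f}" if p: "p \<in> basic_open S f" for p
  proof -
    from p have "p \<in> prime_ideals S" by (simp add: basic_open_def)
    then obtain \<tau> where "\<tau> \<in> cone_top \<sigma>" "p = face_prime \<tau>"
      using prime_ideal_eq_face_prime by metis
    then show ?thesis using p face_prime_in_basic_open_iff[OF _ assms] by simp
  qed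
  moreover have "face_prime \<rho> \<in> basic_open S f" if "\<rho> \<in> cone_top \<sigma>" "\<rho> \<subseteq> vanishing_face f" for \<rho>
    using that face_prime_in_basic_open_iff[OF _ assms] by simp
  ultimately show ?thesis
    unfolding cone_top_face[OF vanishing_face_in[OF assms]] by blast
qed

lemma basic_open_subset_iff:
  assumes "f \<in> carrier S" "g \<in> carrier S"
  shows "basic_open S g \<subseteq> basic_open S f \<longleftrightarrow> vanishing_face g \<subseteq> vanishing_face f"
proof
  assume sub: "basic_open S g \<subseteq> basic_open S f"
  note iff = face_prime_in_basic_open_iff[OF vanishing_face_in[OF assms(2)]]
  have "face_prime (vanishing_face g) \<in> basic_open S g" by (simp only: iff[OF assms(2)] order_refl)
  with sub have "face_prime (vanishing_face g) \<in> basic_open S f" by (rule subsetD)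
  then show "vanishing_face g \<subseteq> vanishing_face f" by (simp only: iff[OF assms(1)])
next
  assume "vanishing_face g \<subseteq> vanishing_face f"
  then have "cone_top (vanishing_face g) \<subseteq> cone_top (vanishing_face f)"
    using assms by (auto simp: cone_top_face[OF vanishing_face_in])
  then have "face_prime ` cone_top (vanishing_face g) \<subseteq> face_prime ` cone_top (vanishing_face f)"
    by (rule image_mono)
  then show "basic_open S g \<subseteq> basic_open S f"
    by (simp only: face_prime_image_cone_top assms)
qed

lemma openin_spec_iff:
  "openin (spec_topology S) U \<longleftrightarrow> (\<exists>A\<subseteq>carrier S. U = \<Union>(basic_open S ` A))"
proof -
  have "{U. \<exists>f\<in>carrier S. U = basic_open S f} = basic_open S ` carrier S" by blast
  then have "openin (spec_topology S) U \<longleftrightarrow> (\<exists>\<U>\<subseteq>basic_open S ` carrier S. U = \<Union>\<U>)"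
    unfolding openin_spec_topology[OF comm_monoid_axioms] union_of_def arbitrary_def
    by (simp add: eq_commute[of U] conj_commute)
  also have "\<dots> \<longleftrightarrow> (\<exists>A\<subseteq>carrier S. U = \<Union>(basic_open S ` A))"
    by (auto simp: subset_image_iff)
  finally show ?thesis .
qed

abbreviation (input) chart_top :: "'v set topology" where
  "chart_top \<equiv> subtopology (fan_topology N \<Delta>) (cone_top \<sigma>)"

lemma openin_cone_top: "\<tau> \<in> cone_top \<sigma> \<Longrightarrow> openin (fan_topology N \<Delta>) (cone_top \<tau>)"
  using cone_top_subset_fan unfolding fan_openin_iff[OF fan] by (auto simp: cone_top_face)

lemma openin_chart_iff:
  "openin chart_top U \<longleftrightarrow> U \<subseteq> cone_top \<sigma> \<and> (\<forall>\<tau>\<in>U. cone_top \<tau> \<subseteq> U)"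
proof -
  have "openin (fan_topology N \<Delta>) (cone_top \<sigma>)"
    by (rule openin_cone_top) (simp add: cone_top_def cone_face_refl)
  then have "openin chart_top U \<longleftrightarrow> openin (fan_topology N \<Delta>) U \<and> U \<subseteq> cone_top \<sigma>"
    by (rule openin_open_subtopology)
  then show ?thesis using cone_top_subset_fan by (auto simp: fan_openin_iff[OF fan])
qed

lemma topspace_chart: "topspace chart_top = cone_top \<sigma>"
  using cone_top_subset_fan by (auto simp: topspace_fan_topology[OF fan])

lemma face_prime_homeomorphic: "homeomorphic_map chart_top (spec_topology S) face_prime"
proof (rule bijective_open_imp_homeomorphic_map)
  show "continuous_map chart_top (spec_topology S) face_prime"
    unfolding continuous_map_def topspace_chart topspace_spec_topology[OF comm_monoid_axioms]
  proof (intro conjI allI impI)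
    show "face_prime \<in> cone_top \<sigma> \<rightarrow> prime_ideals S"
      using face_prime_in_prime_ideals by blast
    fix U assume "openin (spec_topology S) U"
    then obtain A where A: "A \<subseteq> carrier S" "U = \<Union>(basic_open S ` A)"
      unfolding openin_spec_iff by blast
    have "{\<tau> \<in> cone_top \<sigma>. face_prime \<tau> \<in> U} = {\<tau> \<in> cone_top \<sigma>. \<exists>f\<in>A. \<tau> \<subseteq> vanishing_face f}"
    proof -
      have "face_prime \<tau> \<in> basic_open S f \<longleftrightarrow> \<tau> \<subseteq> vanishing_face f" if "\<tau> \<in> cone_top \<sigma>" "f \<in> A" for \<tau> f
        using that A(1) by (intro face_prime_in_basic_open_iff) auto
      then show ?thesis unfolding A(2) UN_iff by blast
    qed
    moreover have "cone_top \<tau> \<subseteq> {\<tau> \<in> cone_top \<sigma>. \<exists>f\<in>A. \<tau> \<subseteq> vanishing_face f}"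
      if "\<tau> \<in> cone_top \<sigma>" "\<exists>f\<in>A. \<tau> \<subseteq> vanishing_face f" for \<tau>
      unfolding cone_top_face[OF that(1)] using that(2) by blast
    ultimately show "openin chart_top {\<tau> \<in> cone_top \<sigma>. face_prime \<tau> \<in> U}"
      unfolding openin_chart_iff by simp
  qed
  show "open_map chart_top (spec_topology S) face_prime"
    unfolding open_map_def
  proof (intro allI impI)
    fix U assume U: "openin chart_top U"
    \<comment> \<open>An open set contains the faces of its members, and each member has an equation in \<open>S\<close>.\<close>
    have "U = (\<Union>f\<in>{f \<in> carrier S. vanishing_face f \<in> U}. cone_top (vanishing_face f))" (is "_ = ?R")
    proof
      show "?R \<subseteq> U" using U by (auto simp: openin_chart_iff)
      show "U \<subseteq> ?R"
      proof
        fix \<tau> assume \<tau>: "\<tau> \<in> U"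
        then obtain f where f: "f \<in> carrier S" "vanishing_face f = \<tau>"
          using U unfolding openin_chart_iff by (meson subsetD vanishing_face_surj)
        then show "\<tau> \<in> ?R" using \<tau> cone_face_refl[of \<tau>] by (auto simp: cone_top_def)
      qed
    qed
    then have "face_prime ` U =
        (\<Union>f\<in>{f \<in> carrier S. vanishing_face f \<in> U}. face_prime ` cone_top (vanishing_face f))"
      by (metis image_UN)
    also have "\<dots> = \<Union>(basic_open S ` {f \<in> carrier S. vanishing_face f \<in> U})"
      by (simp add: face_prime_image_cone_top)
    finally show "openin (spec_topology S) (face_prime ` U)"
      unfolding openin_spec_iff
      by (intro exI[of _ "{f \<in> carrier S. vanishing_face f \<in> U}"]) simp
  qed
  show "face_prime ` topspace chart_top = topspace (spec_topology S)"
    unfolding topspace_chart topspace_spec_topology[OF comm_monoid_axioms]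
    using face_prime_bij by (simp add: bij_betw_def)
  show "inj_on face_prime (topspace chart_top)"
    unfolding topspace_chart using face_prime_bij by (simp add: bij_betw_def)
qed

section \<open>Sections over the spectrum of a cone monoid\<close>

text \<open>The difference \<open>s - n f\<close>, which makes sense in the group of all functions on the ambient
  vector space. Taking the value in this one group, whatever \<open>f\<close> is, turns all restriction maps of
  the spectrum into inclusions, as they are for the fan.\<close>

definition loc_value :: "'s \<Rightarrow> ('s \<times> nat) set \<Rightarrow> 'v \<Rightarrow> real" where
  "loc_value f x = (case SOME y. y \<in> x of (s, n) \<Rightarrow> \<lambda>v. e s v - real n * e f v)"

text \<open>Functions can be cancelled, so the multiple of \<open>f\<close> in the equality of fractions disappears.\<close>

lemma loc_class_eq_iff_value:
  assumes "f \<in> carrier S" "s \<in> carrier S" "t \<in> carrier S"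
  shows "loc_rel S f `` {(s, n)} = loc_rel S f `` {(t, m)} \<longleftrightarrow>
    (\<forall>v. e s v - n * e f v = e t v - m * e f v)"
proof -
  have "f [^] (k + m) \<otimes> s = f [^] (k + n) \<otimes> t \<longleftrightarrow> (\<forall>v. e s v - n * e f v = e t v - m * e f v)"
    for k :: nat
  proof -
    have "f [^] (k + m) \<otimes> s = f [^] (k + n) \<otimes> t \<longleftrightarrow>
        e (f [^] (k + m) \<otimes> s) = e (f [^] (k + n) \<otimes> t)"
      using assms by (subst e_eq_iff) auto
    also have "\<dots> \<longleftrightarrow> (\<forall>v. e s v - n * e f v = e t v - m * e f v)"
      using assms by (simp add: e_mult e_pow fun_eq_iff algebra_simps)
    finally show ?thesis .
  qed
  then show ?thesis using assms by (simp add: loc_class_eq_iff[OF comm_monoid_axioms])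
qed

lemma loc_value_class:
  assumes "f \<in> carrier S" "s \<in> carrier S"
  shows "loc_value f (loc_rel S f `` {(s, n)}) = (\<lambda>v. e s v - n * e f v)"
proof -
  let ?x = "loc_rel S f `` {(s, n)}"
  obtain t m where tm: "(SOME y. y \<in> ?x) = (t, m)" by (cases "SOME y. y \<in> ?x")
  have "(s, n) \<in> ?x" using assms by (auto simp: loc_rel_iff[OF comm_monoid_axioms])
  then have "(t, m) \<in> ?x" by (metis someI tm)
  then have rel: "((s, n), (t, m)) \<in> loc_rel S f" by simp
  then have "t \<in> carrier S" using assms by (simp add: loc_rel_iff[OF comm_monoid_axioms])
  then have "\<forall>v. e s v - n * e f v = e t v - m * e f v"
    using loc_class_eq_iff_value[OF assms] equiv_class_eq[OF equiv_loc_rel[OF comm_monoid_axioms assms(1)] rel] by blast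
  then show ?thesis unfolding loc_value_def tm by (simp add: fun_eq_iff)
qed

text \<open>
  The identity \<open>S\<^sub>\<tau> = S\<^sub>\<sigma> + \<nat>(-f)\<close> for the face \<open>\<tau> = \<sigma> \<inter> f\<^sup>\<bottom>\<close>. Every \<open>u \<in> S\<^sub>\<tau>\<close> is a
  value, because \<open>u\<close> is nonnegative where \<open>f\<close> vanishes on \<open>\<sigma>\<close>, and so \<open>u + n f\<close> is
  nonnegative on \<open>\<sigma>\<close> for large \<open>n\<close>.
\<close>

lemma loc_value_iso:
  assumes f: "f \<in> carrier S"
  shows "loc_value f \<in> monoid_iso (localization S f) (cone_monoid N (vanishing_face f))"
  unfolding monoid_iso_def monoid_hom_def
proof (intro CollectI conjI homI)
  show "loc_value f \<one>\<^bsub>localization S f\<^esub> = \<one>\<^bsub>cone_monoid N (vanishing_face f)\<^esub>"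
    using f by (simp add: localization_def loc_value_class e_one cone_monoid_def)
  show into: "loc_value f x \<in> carrier (cone_monoid N (vanishing_face f))"
    if "x \<in> carrier (localization S f)" for x
  proof -
    obtain s n where s: "s \<in> carrier S" "x = loc_rel S f `` {(s, n)}"
      using localization_carrierE[OF comm_monoid_axioms \<open>x \<in> carrier (localization S f)\<close>] by metis
    have "linear (\<lambda>v. e s v - n * e f v)"
      using linear_compose_sub[OF e_linear[OF s(1)] linear_compose_scale_right[OF e_linear[OF f], of "real n"]]
      by simp
    then show ?thesis
      using f s e_in[OF f] e_in[OF s(1)] e_nonneg[OF s(1)]
      by (auto simp: loc_value_class cone_monoid_def dual_cone_def dual_lattice_def vanishing_face_def
          intro!: Ints_diff Ints_mult)
  qed
  show "loc_value f (x \<otimes>\<^bsub>localization S f\<^esub> y) =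
      loc_value f x \<otimes>\<^bsub>cone_monoid N (vanishing_face f)\<^esub> loc_value f y"
    if "x \<in> carrier (localization S f)" "y \<in> carrier (localization S f)" for x y
  proof -
    obtain s n where s: "s \<in> carrier S" "x = loc_rel S f `` {(s, n)}"
      using localization_carrierE[OF comm_monoid_axioms \<open>x \<in> carrier (localization S f)\<close>] by metis
    obtain t m where t: "t \<in> carrier S" "y = loc_rel S f `` {(t, m)}"
      using localization_carrierE[OF comm_monoid_axioms \<open>y \<in> carrier (localization S f)\<close>] by metis
    show ?thesis
      using f s t
      by (simp add: localization_mult[OF comm_monoid_axioms] loc_value_class e_mult cone_monoid_def fun_eq_iff algebra_simps)
  qed
  show "bij_betw (loc_value f) (carrier (localization S f)) (carrier (cone_monoid N (vanishing_face f)))"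
    unfolding bij_betw_def
  proof
    show "inj_on (loc_value f) (carrier (localization S f))"
    proof (rule inj_onI)
      fix x y assume x: "x \<in> carrier (localization S f)" and y: "y \<in> carrier (localization S f)"
        and eq: "loc_value f x = loc_value f y"
      obtain s n where s: "s \<in> carrier S" "x = loc_rel S f `` {(s, n)}"
        using localization_carrierE[OF comm_monoid_axioms x] by metis
      obtain t m where t: "t \<in> carrier S" "y = loc_rel S f `` {(t, m)}"
        using localization_carrierE[OF comm_monoid_axioms y] by metis
      have "\<forall>v. e s v - n * e f v = e t v - m * e f v"
        using eq f s t by (simp add: loc_value_class fun_eq_iff)
      then show "x = y" using s t loc_class_eq_iff_value[OF f s(1) t(1)] by simp
    qed
    have "u \<in> loc_value f ` carrier (localization S f)"
      if u: "u \<in> dual_cone (vanishing_face f) \<inter> dual_lattice N" for u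
    proof -
      have lin: "linear u" using u by (simp add: dual_cone_def)
      have "0 \<le> u v" if "v \<in> \<sigma>" "e f v = 0" for v
        using u that by (simp add: dual_cone_def vanishing_face_def)
      then obtain n :: nat where n: "\<And>v. v \<in> \<sigma> \<Longrightarrow> 0 \<le> u v + n * e f v"
        using cone_functional_dominated[OF rational_cone e_in[OF f] lin] by auto
      have "(\<lambda>v. u v + n * e f v) \<in> dual_cone \<sigma> \<inter> dual_lattice N"
        using n linear_compose_add[OF lin linear_compose_scale_right[OF e_linear[OF f], of "real n"]]
          e_in[OF f] u
        by (auto simp: dual_cone_def dual_lattice_def intro!: Ints_add Ints_mult)
      then obtain s where s: "s \<in> carrier S" "e s = (\<lambda>v. u v + n * e f v)"
        by (rule e_surj)
      then have "loc_value f (loc_rel S f `` {(s, n)}) = u"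
        using f by (simp add: loc_value_class)
      then show ?thesis using localization_carrierI[OF comm_monoid_axioms s(1)] by (metis image_eqI)
    qed
    then show "loc_value f ` carrier (localization S f) = carrier (cone_monoid N (vanishing_face f))"
      using into by (auto simp: cone_monoid_def)
  qed
qed

text \<open>If \<open>a g = f + h\<close>, the image of \<open>s - n f\<close> is represented by \<open>(s + n h) - a n g\<close>, which is the
  same function.\<close>

lemma loc_map_value:
  assumes f: "f \<in> carrier S" and g: "g \<in> carrier S" and sub: "basic_open S g \<subseteq> basic_open S f"
    and x: "x \<in> carrier (localization S f)"
  shows "loc_map S f g x \<in> carrier (localization S g)"
    and "loc_value g (loc_map S f g x) = loc_value f x"
proof -
  obtain s n where s: "s \<in> carrier S" "x = loc_rel S f `` {(s, n)}"
    using localization_carrierE[OF comm_monoid_axioms x] by metis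
  obtain h and a :: nat where h: "h \<in> carrier S" "g [^] a = f \<otimes> h"
    using basic_open_subset_imp[OF comm_monoid_axioms sub f g] .
  have x': "loc_map S f g x = loc_rel S g `` {(s \<otimes> h [^] n, a * n)}"
    unfolding s(2) by (rule loc_map_class[OF comm_monoid_axioms f g h s(1)])
  show "loc_map S f g x \<in> carrier (localization S g)"
    unfolding x' using s h by (intro localization_carrierI[OF comm_monoid_axioms]) simp
  have "a * e g v = e f v + e h v" for v
    using e_pow[OF g, of a] e_mult[OF f h(1)] h(2) by (metis)
  then have "(a * n) * e g v = n * (e f v + e h v)" for v
    by (metis mult.assoc mult.commute of_nat_mult)
  then show "loc_value g (loc_map S f g x) = loc_value f x"
    unfolding x' unfolding s(2) using f g h s
    by (simp add: loc_value_class e_mult e_pow fun_eq_iff algebra_simps)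
qed

text \<open>One chosen \<open>f\<close> for each face. By \<open>spec_section_value\<close> below, the value of a section at \<open>f\<close> depends
  on the face only, so the choice does not influence the isomorphism of sheaves.\<close>

definition face_equation :: "'v set \<Rightarrow> 's" where
  "face_equation \<tau> = (SOME f. f \<in> carrier S \<and> vanishing_face f = \<tau>)"

lemma face_equation:
  assumes "\<tau> \<in> cone_top \<sigma>"
  shows "face_equation \<tau> \<in> carrier S" "vanishing_face (face_equation \<tau>) = \<tau>"
proof -
  have "\<exists>f. f \<in> carrier S \<and> vanishing_face f = \<tau>"
    using vanishing_face_surj[OF assms] by metis
  from someI_ex[OF this] show "face_equation \<tau> \<in> carrier S" "vanishing_face (face_equation \<tau>) = \<tau>"
    by (simp_all add: face_equation_def)
qed

abbreviation (input) face_preimage :: "'s set set \<Rightarrow> 'v set set" where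
  "face_preimage V \<equiv> {\<tau> \<in> cone_top \<sigma>. face_prime \<tau> \<in> V}"

definition section_map :: "'s set set \<Rightarrow> ('s \<Rightarrow> ('s \<times> nat) set) \<Rightarrow> 'v set \<Rightarrow> 'v \<Rightarrow> real" where
  "section_map V s = (\<lambda>\<tau>\<in>{\<tau> \<in> \<Delta>. cone_top \<tau> \<subseteq> face_preimage V}.
     loc_value (face_equation \<tau>) (s (face_equation \<tau>)))"

lemma cone_top_subset_preimage_iff:
  assumes "f \<in> carrier S"
  shows "cone_top (vanishing_face f) \<subseteq> face_preimage V \<longleftrightarrow> basic_open S f \<subseteq> V"
  using assms face_prime_image_cone_top[OF assms, symmetric]
  by (auto simp: cone_top_face[OF vanishing_face_in])

text \<open>The basic open sets that index the sections over an open set \<open>V\<close> of the spectrum and over its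
  preimage are matched by \<open>face_equation\<close>.\<close>

lemma section_index_iff:
  "\<tau> \<in> \<Delta> \<and> cone_top \<tau> \<subseteq> face_preimage V \<longleftrightarrow>
     \<tau> \<in> cone_top \<sigma> \<and> basic_open S (face_equation \<tau>) \<subseteq> V"
proof (cases "\<tau> \<in> cone_top \<sigma>")
  case True
  then show ?thesis
    using cone_top_subset_preimage_iff[OF face_equation(1)[OF True]] face_equation(2)[OF True]
      cone_top_subset_fan by auto
next
  case False
  then show ?thesis using cone_face_refl[of \<tau>] by (auto simp: cone_top_def)
qed

lemma spec_sections_carrier_iff:
  "s \<in> carrier (sections (Spec S) V) \<longleftrightarrow>
     s \<in> extensional {f \<in> carrier S. basic_open S f \<subseteq> V} \<and>
     (\<forall>f\<in>carrier S. basic_open S f \<subseteq> V \<longrightarrow> s f \<in> carrier (localization S f)) \<and>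
     (\<forall>f\<in>carrier S. \<forall>g\<in>carrier S. basic_open S f \<subseteq> V \<longrightarrow> basic_open S g \<subseteq> basic_open S f \<longrightarrow>
        loc_map S f g (s f) = s g)"
  by (simp add: Spec_def base_mspace_simps base_sections_carrier_iff)

lemma spec_section_value:
  assumes s: "s \<in> carrier (sections (Spec S) V)"
    and f: "f \<in> carrier S" and g: "g \<in> carrier S"
    and V: "basic_open S f \<subseteq> V" and sub: "vanishing_face g \<subseteq> vanishing_face f"
  shows "loc_value g (s g) = loc_value f (s f)"
proof -
  have D: "basic_open S g \<subseteq> basic_open S f" using sub f g by (simp add: basic_open_subset_iff)
  have "s f \<in> carrier (localization S f)" "loc_map S f g (s f) = s g"
    using s f g V D by (simp_all add: spec_sections_carrier_iff)
  then show ?thesis using loc_map_value(2)[OF f g D] by metis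
qed

lemma fan_sections_carrier_iff:
  "t \<in> carrier (sections (fan_mspace N \<Delta>) U) \<longleftrightarrow>
     t \<in> extensional {\<tau> \<in> \<Delta>. cone_top \<tau> \<subseteq> U} \<and>
     (\<forall>\<tau>\<in>\<Delta>. cone_top \<tau> \<subseteq> U \<longrightarrow> t \<tau> \<in> carrier (cone_monoid N \<tau>)) \<and>
     (\<forall>\<tau>\<in>\<Delta>. \<forall>\<rho>\<in>\<Delta>. cone_top \<tau> \<subseteq> U \<longrightarrow> cone_top \<rho> \<subseteq> cone_top \<tau> \<longrightarrow> t \<tau> = t \<rho>)"
  by (simp add: fan_mspace_def base_mspace_simps base_sections_carrier_iff)

lemma section_map_hom:
  "section_map V \<in> monoid_hom (sections (Spec S) V) (sections (fan_mspace N \<Delta>) (face_preimage V))"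
  unfolding monoid_hom_def
proof (intro CollectI conjI homI)
  have hom: "loc_value (face_equation \<tau>) \<in> monoid_hom (localization S (face_equation \<tau>)) (cone_monoid N \<tau>)"
    if "\<tau> \<in> cone_top \<sigma>" for \<tau>
    using loc_value_iso[OF face_equation(1)[OF that]] face_equation(2)[OF that]
    by (simp add: monoid_iso_def)
  show "section_map V \<one>\<^bsub>sections (Spec S) V\<^esub> = \<one>\<^bsub>sections (fan_mspace N \<Delta>) (face_preimage V)\<^esub>"
    unfolding section_map_def Spec_def fan_mspace_def base_mspace_simps base_sections_one
    by (rule restrict_ext) (use hom face_equation in \<open>simp add: section_index_iff monoid_hom_def\<close>)
  fix s assume s: "s \<in> carrier (sections (Spec S) V)"
  have sf: "s (face_equation \<tau>) \<in> carrier (localization S (face_equation \<tau>))"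
    if "s \<in> carrier (sections (Spec S) V)" "\<tau> \<in> cone_top \<sigma>" "basic_open S (face_equation \<tau>) \<subseteq> V" for s \<tau>
    using that face_equation(1)[of \<tau>] by (simp add: spec_sections_carrier_iff)
  show "section_map V s \<in> carrier (sections (fan_mspace N \<Delta>) (face_preimage V))"
    unfolding fan_sections_carrier_iff
  proof (intro conjI ballI impI)
    show "section_map V s \<in> extensional {\<tau> \<in> \<Delta>. cone_top \<tau> \<subseteq> face_preimage V}"
      by (simp add: section_map_def)
    fix \<tau> assume \<tau>': "\<tau> \<in> \<Delta>" "cone_top \<tau> \<subseteq> face_preimage V"
    then have \<tau>: "\<tau> \<in> cone_top \<sigma>" "basic_open S (face_equation \<tau>) \<subseteq> V"
      using section_index_iff by blast+
    show "section_map V s \<tau> \<in> carrier (cone_monoid N \<tau>)"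
      using hom[OF \<tau>(1)] sf[OF s \<tau>] \<tau>' by (auto simp: section_map_def monoid_hom_def hom_def)
    fix \<rho> assume \<rho>': "\<rho> \<in> \<Delta>" "cone_top \<rho> \<subseteq> cone_top \<tau>"
    have \<rho>V: "cone_top \<rho> \<subseteq> face_preimage V" using \<tau>'(2) \<rho>'(2) by (rule order_trans[rotated])
    then have \<rho>: "\<rho> \<in> cone_top \<sigma>" using \<rho>'(1) section_index_iff by blast
    have "\<rho> \<subseteq> \<tau>" using \<rho>'(2) cone_face_refl[of \<rho>] by (auto simp: cone_top_def cone_face_def)
    then have "loc_value (face_equation \<rho>) (s (face_equation \<rho>)) =
        loc_value (face_equation \<tau>) (s (face_equation \<tau>))"
      using s \<tau> \<rho> by (intro spec_section_value) (simp_all add: face_equation)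
    then show "section_map V s \<tau> = section_map V s \<rho>"
      using \<tau>' \<rho>'(1) \<rho>V by (simp add: section_map_def)
  qed
  fix t assume t: "t \<in> carrier (sections (Spec S) V)"
  show "section_map V (s \<otimes>\<^bsub>sections (Spec S) V\<^esub> t) =
      section_map V s \<otimes>\<^bsub>sections (fan_mspace N \<Delta>) (face_preimage V)\<^esub> section_map V t"
    unfolding section_map_def Spec_def fan_mspace_def base_mspace_simps base_sections_mult
  proof (rule restrict_ext)
    fix \<tau> assume \<tau>': "\<tau> \<in> {\<tau> \<in> \<Delta>. cone_top \<tau> \<subseteq> face_preimage V}"
    then have \<tau>: "\<tau> \<in> cone_top \<sigma>" "basic_open S (face_equation \<tau>) \<subseteq> V"
      using section_index_iff by blast+
    let ?J = "{f \<in> carrier S. basic_open S f \<subseteq> V}"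
    have "face_equation \<tau> \<in> ?J" using \<tau> by (simp add: face_equation)
    then show "loc_value (face_equation \<tau>) ((\<lambda>f\<in>?J. s f \<otimes>\<^bsub>localization S f\<^esub> t f) (face_equation \<tau>)) =
        (\<lambda>\<tau>\<in>{\<tau> \<in> \<Delta>. cone_top \<tau> \<subseteq> face_preimage V}. loc_value (face_equation \<tau>) (s (face_equation \<tau>))) \<tau>
        \<otimes>\<^bsub>cone_monoid N \<tau>\<^esub>
        (\<lambda>\<tau>\<in>{\<tau> \<in> \<Delta>. cone_top \<tau> \<subseteq> face_preimage V}. loc_value (face_equation \<tau>) (t (face_equation \<tau>))) \<tau>"
      using hom[OF \<tau>(1)] sf[OF s \<tau>] sf[OF t \<tau>] \<tau>' by (simp add: monoid_hom_def hom_def)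
  qed
qed

text \<open>Both kinds of sections are compatible families of functionals, one for each face of \<open>\<sigma>\<close> in the
  preimage of \<open>V\<close>; on the side of the spectrum the family is repeated for all \<open>f\<close> that define the
  same face, which costs nothing because the values agree.\<close>

lemma section_map_bij:
  "bij_betw (section_map V) (carrier (sections (Spec S) V))
     (carrier (sections (fan_mspace N \<Delta>) (face_preimage V)))"
  unfolding bij_betw_def
proof
  have map_value: "section_map V s (vanishing_face f) = loc_value f (s f)"
    if s: "s \<in> carrier (sections (Spec S) V)" and f: "f \<in> carrier S" "basic_open S f \<subseteq> V" for s f
  proof -
    let ?\<tau> = "vanishing_face f"
    have \<tau>: "?\<tau> \<in> cone_top \<sigma>" using f(1) by (rule vanishing_face_in)
    then have "?\<tau> \<in> \<Delta>" "cone_top ?\<tau> \<subseteq> face_preimage V"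
      using cone_top_subset_fan f by (auto simp: cone_top_subset_preimage_iff)
    then have "section_map V s ?\<tau> = loc_value (face_equation ?\<tau>) (s (face_equation ?\<tau>))"
      by (simp add: section_map_def)
    also have "\<dots> = loc_value f (s f)"
      by (rule spec_section_value[OF s f(1) _ f(2)]) (simp_all add: face_equation \<tau>)
    finally show ?thesis .
  qed
  have inj: "inj_on (loc_value f) (carrier (localization S f))"
    and onto: "loc_value f ` carrier (localization S f) = carrier (cone_monoid N (vanishing_face f))"
    if "f \<in> carrier S" for f
    using loc_value_iso[OF that] by (simp_all add: monoid_iso_def bij_betw_def)
  show "inj_on (section_map V) (carrier (sections (Spec S) V))"
  proof (rule inj_onI)
    fix s t assume s: "s \<in> carrier (sections (Spec S) V)" and t: "t \<in> carrier (sections (Spec S) V)"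
      and eq: "section_map V s = section_map V t"
    show "s = t"
    proof
      fix f
      show "s f = t f"
      proof (cases "f \<in> carrier S \<and> basic_open S f \<subseteq> V")
        case True
        then have "loc_value f (s f) = loc_value f (t f)"
          using map_value[OF s] map_value[OF t] eq by metis
        moreover have "s f \<in> carrier (localization S f)" "t f \<in> carrier (localization S f)"
          using s t True by (simp_all add: spec_sections_carrier_iff)
        ultimately show ?thesis using inj True by (meson inj_onD)
      next
        case False
        then show ?thesis using s t by (auto simp: spec_sections_carrier_iff extensional_def)
      qed
    qed
  qed
  show "section_map V ` carrier (sections (Spec S) V) =
      carrier (sections (fan_mspace N \<Delta>) (face_preimage V))"
  proof
    show "section_map V ` carrier (sections (Spec S) V) \<subseteq>
        carrier (sections (fan_mspace N \<Delta>) (face_preimage V))"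
      using section_map_hom by (auto simp: monoid_hom_def hom_def)
    show "carrier (sections (fan_mspace N \<Delta>) (face_preimage V)) \<subseteq>
        section_map V ` carrier (sections (Spec S) V)"
    proof
      fix t assume t: "t \<in> carrier (sections (fan_mspace N \<Delta>) (face_preimage V))"
      define s where "s = (\<lambda>f\<in>{f \<in> carrier S. basic_open S f \<subseteq> V}.
        inv_into (carrier (localization S f)) (loc_value f) (t (vanishing_face f)))"
      have index: "vanishing_face f \<in> \<Delta>" "cone_top (vanishing_face f) \<subseteq> face_preimage V"
        if f: "f \<in> carrier S" "basic_open S f \<subseteq> V" for f
        using cone_top_subset_fan vanishing_face_in[OF f(1)] cone_top_subset_preimage_iff[OF f(1)] f(2)
        by blast+
      have sval: "s f \<in> carrier (localization S f) \<and> loc_value f (s f) = t (vanishing_face f)"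
        if f: "f \<in> carrier S" "basic_open S f \<subseteq> V" for f
      proof -
        have "t (vanishing_face f) \<in> carrier (cone_monoid N (vanishing_face f))"
          using t index[OF f] unfolding fan_sections_carrier_iff by blast
        then have "t (vanishing_face f) \<in> loc_value f ` carrier (localization S f)"
          using onto[OF f(1)] by simp
        from inv_into_into[OF this] f_inv_into_f[OF this] show ?thesis using f by (simp add: s_def)
      qed
      have s: "s \<in> carrier (sections (Spec S) V)"
        unfolding spec_sections_carrier_iff
      proof (intro conjI ballI impI)
        show "s \<in> extensional {f \<in> carrier S. basic_open S f \<subseteq> V}" by (simp add: s_def)
        fix f assume f: "f \<in> carrier S" "basic_open S f \<subseteq> V"
        show "s f \<in> carrier (localization S f)" using sval[OF f] by blast
        fix g assume g: "g \<in> carrier S" "basic_open S g \<subseteq> basic_open S f"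
        have gV: "basic_open S g \<subseteq> V" using g(2) f(2) by (rule order_trans)
        have "cone_top (vanishing_face g) \<subseteq> cone_top (vanishing_face f)"
          using f(1) g by (auto simp: basic_open_subset_iff cone_top_face[OF vanishing_face_in])
        then have "t (vanishing_face f) = t (vanishing_face g)"
          using t index[OF f] index[OF g(1) gV] unfolding fan_sections_carrier_iff by blast
        then have "loc_value g (loc_map S f g (s f)) = loc_value g (s g)"
          using sval[OF f] sval[OF g(1) gV] loc_map_value(2)[OF f(1) g] by simp
        then show "loc_map S f g (s f) = s g"
          using inj[OF g(1)] sval[OF f] sval[OF g(1) gV] loc_map_value(1)[OF f(1) g]
          by (meson inj_onD)
      qed
      have "section_map V s = t"
      proof
        fix \<tau>
        show "section_map V s \<tau> = t \<tau>"
        proof (cases "\<tau> \<in> \<Delta> \<and> cone_top \<tau> \<subseteq> face_preimage V")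
          case True
          then have "\<tau> \<in> cone_top \<sigma>" "basic_open S (face_equation \<tau>) \<subseteq> V"
            using section_index_iff by blast+
          then show ?thesis
            using True sval[of "face_equation \<tau>"] by (simp add: section_map_def face_equation)
        next
          case False
          then show ?thesis
            using t by (auto simp: fan_sections_carrier_iff extensional_def section_map_def)
        qed
      qed
      then show "t \<in> section_map V ` carrier (sections (Spec S) V)" using s by blast
    qed
  qed
qed

lemma section_map_restr:
  assumes "W \<subseteq> V"
  shows "section_map W (restr (Spec S) V W s) =
    restr (fan_mspace N \<Delta>) (face_preimage V) (face_preimage W) (section_map V s)"
  unfolding Spec_def fan_mspace_def base_mspace_simps
proof
  fix \<tau>
  show "section_map W (restrict s {f \<in> carrier S. basic_open S f \<subseteq> W}) \<tau> =
    restrict (section_map V s) {\<tau> \<in> \<Delta>. cone_top \<tau> \<subseteq> face_preimage W} \<tau>"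
  proof (cases "\<tau> \<in> \<Delta> \<and> cone_top \<tau> \<subseteq> face_preimage W")
    case True
    then have "\<tau> \<in> cone_top \<sigma>" "basic_open S (face_equation \<tau>) \<subseteq> W"
      using section_index_iff by blast+
    moreover have "cone_top \<tau> \<subseteq> face_preimage V" using True assms by blast
    ultimately show ?thesis using True by (simp add: section_map_def face_equation)
  next
    case False
    then show ?thesis by (auto simp: section_map_def)
  qed
qed

lemma isomorphic_to_Spec:
  "isomorphic_mspaces (open_subspace (fan_mspace N \<Delta>) (cone_top \<sigma>)) (Spec S)"
proof -
  have sp: "space_top (open_subspace (fan_mspace N \<Delta>) (cone_top \<sigma>)) = chart_top"
    "sections (open_subspace (fan_mspace N \<Delta>) (cone_top \<sigma>)) = sections (fan_mspace N \<Delta>)"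
    "restr (open_subspace (fan_mspace N \<Delta>) (cone_top \<sigma>)) = restr (fan_mspace N \<Delta>)"
    "space_top (Spec S) = spec_topology S"
    by (simp_all add: open_subspace_def fan_mspace_def Spec_def base_mspace_simps)
  show ?thesis
    unfolding isomorphic_mspaces_def sp topspace_chart Let_def
    using face_prime_homeomorphic section_map_hom section_map_bij section_map_restr
    by (intro exI[of _ face_prime] exI[of _ section_map]) (simp add: monoid_iso_def)
qed

end

theorem theorem2p2:
  fixes N :: "'v::real_vector set" and d :: nat and \<Delta> :: "'v set set"
  assumes "lattice_of_rank d N" and "lattice_fan N \<Delta>"
  shows "mspace_fan (fan_mspace N \<Delta>)"
  unfolding mspace_fan_def
proof (intro conjI ballI)
  have top: "space_top (fan_mspace N \<Delta>) = fan_topology N \<Delta>"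
    by (simp add: fan_mspace_def base_mspace_simps)
  show sheaf: "monoided_space (fan_mspace N \<Delta>)"
    using assms(2) by (rule monoided_space_fan_mspace)
  fix \<sigma> assume "\<sigma> \<in> topspace (space_top (fan_mspace N \<Delta>))"
  then have \<sigma>: "\<sigma> \<in> \<Delta>" by (simp add: top topspace_fan_topology[OF assms(2)])
  define S where "S = sections (fan_mspace N \<Delta>) (cone_top \<sigma>)"
  have op: "openin (fan_topology N \<Delta>) (cone_top \<sigma>)"
    using fan_cone_top_eq[OF assms(2)] \<sigma> unfolding fan_openin_iff[OF assms(2)] by fastforce
  then have "comm_monoid S"
    using sheaf by (simp add: S_def monoided_space_def presheaf_of_monoids_def top)
  moreover have "(\<lambda>s. s \<sigma>) \<in> monoid_iso S (cone_monoid N \<sigma>)"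
    unfolding S_def using \<sigma> by (rule fan_sections_iso)
  ultimately have "affine_chart S N d \<Delta> \<sigma> (\<lambda>s. s \<sigma>)"
    using assms \<sigma> by (simp add: affine_chart_def affine_chart_axioms_def)
  then have "isomorphic_mspaces (open_subspace (fan_mspace N \<Delta>) (cone_top \<sigma>)) (Spec S)"
    by (rule affine_chart.isomorphic_to_Spec)
  then show "\<exists>U. openin (space_top (fan_mspace N \<Delta>)) U \<and> \<sigma> \<in> U \<and>
      (\<exists>S :: ('v set \<Rightarrow> 'v \<Rightarrow> real) monoid.
         comm_monoid S \<and> isomorphic_mspaces (open_subspace (fan_mspace N \<Delta>) U) (Spec S))"
    using op \<open>comm_monoid S\<close> cone_face_refl[of \<sigma>] by (auto simp: top cone_top_def)
qed

end
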